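(* Let $\{G_n\}_{n=1}^{\infty}$ be a sequence of finite simple graphs such that $|E(G_n)|$ increases with $n$ and $\Delta(G_n)^2=o(|E(G_n)|)$ as $n\to\infty$. Then the Laplacian coefficients $c(G_n,k)$ are asymptotically normal (by central and local limit theorems).
   Context: For a finite simple graph $G$ with $N$ vertices, let $L(G)=D(G)-A(G)$ be its Laplacian matrix ($D(G)$ the diagonal degree matrix, $A(G)$ the adjacency matrix), and write its characteristic polynomial as $\det(xI-L(G))=\sum_{k=0}^{N}(-1)^{N-k}c(G,k)x^k$; the numbers $c(G,k)\ge 0$ are the Laplacian coefficients. $\Delta(G)$ denotes the maximum vertex degree and $E(G)$ the edge set. For the sequence $G_n$ with $N_n=|V(G_n)|$, let $p(n,k)=c(G_n,k)/\sum_{j=0}^{N_n}c(G_n,j)$ for $0\le k\le N_n$, and let $\mu_n$ and $\sigma_n^2$ be the mean and variance of the probability distribution $(p(n,k))_k$. The coefficients are asymptotically normal by a central limit theorem if $\lim_{n\to\infty}\sup_{x\in\mathbb{R}}\left|\sum_{k\le \mu_n+x\sigma_n}p(n,k)-\frac{1}{\sqrt{2\pi}}\int_{-\infty}^x e^{-t^2/2}dt\right|=0$, and by a local limit theorem if $\lim_{n\to\infty}\sup_{x\in\mathbb{R}}\left|\sigma_n p(n,\lfloor\mu_n+x\sigma_n\rfloor)-\frac{1}{\sqrt{2\pi}}e^{-x^2/2}\right|=0$. *)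

theory Defs
  imports "Jordan_Normal_Form.Char_Poly" "HOL-Analysis.Analysis" "HOL-Library.Landau_Symbols"
begin

definition simple_graph :: "nat \<Rightarrow> (nat \<Rightarrow> nat \<Rightarrow> bool) \<Rightarrow> bool" where
  "simple_graph N adj \<longleftrightarrow> (\<forall>i j. adj i j \<longrightarrow> i < N \<and> j < N \<and> i \<noteq> j \<and> adj j i)"

definition vdegree :: "nat \<Rightarrow> (nat \<Rightarrow> nat \<Rightarrow> bool) \<Rightarrow> nat \<Rightarrow> nat" where
  "vdegree N adj i = card {j. j < N \<and> adj i j}"

definition max_degree :: "nat \<Rightarrow> (nat \<Rightarrow> nat \<Rightarrow> bool) \<Rightarrow> nat" where
  "max_degree N adj = Max (insert 0 (vdegree N adj ` {..<N}))"

definition num_edges :: "nat \<Rightarrow> (nat \<Rightarrow> nat \<Rightarrow> bool) \<Rightarrow> nat" where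
  "num_edges N adj = card {(i, j). i < j \<and> j < N \<and> adj i j}"

definition laplacian :: "nat \<Rightarrow> (nat \<Rightarrow> nat \<Rightarrow> bool) \<Rightarrow> real Matrix.mat" where
  "laplacian N adj = Matrix.mat N N (\<lambda>(i, j).
     (if i = j then real (vdegree N adj i) else 0) - (if adj i j then 1 else 0))"

text \<open>Laplacian coefficients: det(xI - L) = sum_k (-1)^(N-k) c(G,k) x^k.\<close>
definition lap_coeff :: "nat \<Rightarrow> (nat \<Rightarrow> nat \<Rightarrow> bool) \<Rightarrow> nat \<Rightarrow> real" where
  "lap_coeff N adj k = (-1) ^ (N - k) * coeff (char_poly (laplacian N adj)) k"

definition lap_prob :: "nat \<Rightarrow> (nat \<Rightarrow> nat \<Rightarrow> bool) \<Rightarrow> int \<Rightarrow> real" where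
  "lap_prob N adj k = (if 0 \<le> k \<and> k \<le> int N
     then lap_coeff N adj (nat k) / (\<Sum>j\<le>N. lap_coeff N adj j) else 0)"

definition lap_mean :: "nat \<Rightarrow> (nat \<Rightarrow> nat \<Rightarrow> bool) \<Rightarrow> real" where
  "lap_mean N adj = (\<Sum>k\<le>N. real k * lap_prob N adj (int k))"

definition lap_var :: "nat \<Rightarrow> (nat \<Rightarrow> nat \<Rightarrow> bool) \<Rightarrow> real" where
  "lap_var N adj = (\<Sum>k\<le>N. (real k - lap_mean N adj)^2 * lap_prob N adj (int k))"

definition lap_sd :: "nat \<Rightarrow> (nat \<Rightarrow> nat \<Rightarrow> bool) \<Rightarrow> real" where
  "lap_sd N adj = sqrt (lap_var N adj)"

definition std_normal_cdf :: "real \<Rightarrow> real" where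
  "std_normal_cdf x = (1 / sqrt (2 * pi)) * (LBINT t:{..x}. exp (- (t^2) / 2))"

definition lap_CLT :: "(nat \<Rightarrow> nat) \<Rightarrow> (nat \<Rightarrow> nat \<Rightarrow> nat \<Rightarrow> bool) \<Rightarrow> bool" where
  "lap_CLT N adj \<longleftrightarrow>
     (\<lambda>n. SUP x::real. \<bar>(\<Sum>k\<in>{k. k \<le> N n \<and> real k \<le> lap_mean (N n) (adj n) + x * lap_sd (N n) (adj n)}.
                             lap_prob (N n) (adj n) (int k)) - std_normal_cdf x\<bar>) \<longlonglongrightarrow> 0"

definition lap_LLT :: "(nat \<Rightarrow> nat) \<Rightarrow> (nat \<Rightarrow> nat \<Rightarrow> nat \<Rightarrow> bool) \<Rightarrow> bool" where
  "lap_LLT N adj \<longleftrightarrow>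
     (\<lambda>n. SUP x::real. \<bar>lap_sd (N n) (adj n) *
            lap_prob (N n) (adj n) \<lfloor>lap_mean (N n) (adj n) + x * lap_sd (N n) (adj n)\<rfloor>
          - exp (- (x^2) / 2) / sqrt (2 * pi)\<bar>) \<longlonglongrightarrow> 0"

end

theory Submission
  imports Defs "Jordan_Normal_Form.Schur_Decomposition" "HOL-Probability.Probability"
begin

text \<open>The Laplacian eigenvalues \<open>l\<^sub>i\<close> are real with \<open>0 \<le> l\<^sub>i \<le> 2\<Delta>\<close> and \<open>\<Sum>l\<^sub>i = 2\<bar>E\<bar>\<close>, so
  \<open>\<Sum>c(G,k) x\<^sup>k = \<Prod>(x + l\<^sub>i)\<close> and the normalised coefficients are the distribution of a sum of
  independent Bernoulli variables with success probabilities \<open>1 / (1 + l\<^sub>i)\<close>. Its variance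
  \<open>\<Sum>l\<^sub>i / (1 + l\<^sub>i)\<^sup>2\<close> is at least \<open>2\<bar>E\<bar> / (1 + 2\<Delta>)\<^sup>2\<close>, which tends to infinity. A Taylor estimate of the
  factors shows that the standardised characteristic function tends to \<open>exp (- s\<^sup>2 / 2)\<close>; Levy's
  continuity theorem then gives the central limit theorem. The same function is dominated by
  \<open>exp (- 2 s\<^sup>2 / \<pi>\<^sup>2)\<close> for \<open>\<bar>s\<bar> \<le> \<pi>\<sigma>\<close>, so Fourier inversion on this interval and dominated
  convergence give the local limit theorem, uniformly in \<open>k\<close>.\<close>

section \<open>The Laplacian spectrum\<close>

lemma trace_mult_comm:
  fixes A B :: "'a :: comm_semiring_0 Matrix.mat"
  assumes "A \<in> carrier_mat n n" "B \<in> carrier_mat n n"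
  shows "(\<Sum>i<n. (A * B) $$ (i, i)) = (\<Sum>i<n. (B * A) $$ (i, i))"
proof -
  have "(\<Sum>i<n. (A * B) $$ (i, i)) = (\<Sum>i<n. \<Sum>j<n. A $$ (i, j) * B $$ (j, i))"
    using assms by (intro sum.cong) (auto simp: scalar_prod_def atLeast0LessThan)
  also have "\<dots> = (\<Sum>j<n. \<Sum>i<n. B $$ (j, i) * A $$ (i, j))"
    by (subst sum.swap) (simp add: mult.commute)
  also have "\<dots> = (\<Sum>i<n. (B * A) $$ (i, i))"
    using assms by (intro sum.cong) (auto simp: scalar_prod_def atLeast0LessThan)
  finally show ?thesis .
qed

text \<open>Schur decomposition writes \<open>A = P * B * Q\<close> with the given roots on the
  diagonal of \<open>B\<close>; cyclicity of the trace and \<open>Q * P = 1\<close> then remove the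
  conjugation.\<close>

lemma trace_eq_sum_roots:
  fixes A :: "complex Matrix.mat"
  assumes A: "A \<in> carrier_mat n n" and cp: "char_poly A = (\<Prod>a\<leftarrow>as. [:- a, 1:])"
  shows "(\<Sum>i<n. A $$ (i, i)) = sum_list as"
proof -
  obtain B P Q where "schur_decomposition A as = (B, P, Q)"
    by (cases "schur_decomposition A as") auto
  from schur_decomposition[OF A cp this]
  have wit: "similar_mat_wit A B P Q" and diag: "diag_mat B = as" by auto
  from similar_mat_witD2[OF A wit]
  have c: "B \<in> carrier_mat n n" "P \<in> carrier_mat n n" "Q \<in> carrier_mat n n"
    and QP: "Q * P = 1\<^sub>m n" and eq: "A = P * B * Q" by auto
  have "(\<Sum>i<n. A $$ (i, i)) = (\<Sum>i<n. (P * (B * Q)) $$ (i, i))"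
    using c by (simp add: eq assoc_mult_mat[of P n n B n Q n])
  also have "\<dots> = (\<Sum>i<n. (B * Q * P) $$ (i, i))"
    using c by (intro trace_mult_comm) auto
  also have "B * Q * P = B"
    using c QP by (simp add: assoc_mult_mat[of B n n Q n P n])
  also have "(\<Sum>i<n. B $$ (i, i)) = sum_list (diag_mat B)"
    using c by (simp add: diag_mat_def sum_list_sum_nth atLeast0LessThan)
  finally show ?thesis by (simp add: diag)
qed

lemma vdegree_sum:
  "real (vdegree N adj i) = (\<Sum>j<N. if adj i j then 1 else 0)"
proof -
  have "(\<Sum>j<N. if adj i j then 1 else (0::real)) = (\<Sum>j\<in>{j. j < N \<and> adj i j}. 1)"
    by (rule sum.mono_neutral_cong_right) auto
  then show ?thesis by (simp add: vdegree_def)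
qed

lemma vdegree_le_max_degree: "i < N \<Longrightarrow> vdegree N adj i \<le> max_degree N adj"
  by (auto simp: max_degree_def intro!: Max_ge)

lemma handshake:
  assumes "simple_graph N adj"
  shows "(\<Sum>i<N. vdegree N adj i) = 2 * num_edges N adj"
proof -
  let ?E = "{(i, j). i < j \<and> j < N \<and> adj i j}"
  let ?A = "SIGMA i:{..<N}. {j. j < N \<and> adj i j}"
  have sym: "adj j i" "i \<noteq> j" if "adj i j" for i j
    using assms that by (auto simp: simple_graph_def)
  have fin: "finite ?E" by (rule finite_subset[of _ "{..<N} \<times> {..<N}"]) auto
  \<comment> \<open>Ordered adjacent pairs split into the increasing ones and their mirror images,
    so every edge is counted twice.\<close>
  have un: "?A = ?E \<union> prod.swap ` ?E"
    using sym by (force simp: image_iff)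
  have disj: "?E \<inter> prod.swap ` ?E = {}" by auto
  have "(\<Sum>i<N. vdegree N adj i) = card ?A"
    by (simp add: vdegree_def)
  also have "\<dots> = card ?E + card (prod.swap ` ?E)"
    unfolding un using fin disj by (intro card_Un_disjoint) auto
  also have "card (prod.swap ` ?E) = card ?E"
    by (intro card_image) auto
  finally show ?thesis by (simp add: num_edges_def)
qed

text \<open>The Rayleigh quotient of the Laplacian is
  \<open>\<Sum>\<^bsub>ij\<in>E\<^esub> \<bar>v\<^sub>i - v\<^sub>j\<bar>\<^sup>2 / \<Sum>\<^sub>i \<bar>v\<^sub>i\<bar>\<^sup>2\<close>.\<close>

lemma laplacian_eigenvalue:
  assumes G: "simple_graph N adj"
    and ev: "eigenvalue (map_mat complex_of_real (laplacian N adj)) a"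
  shows "\<exists>r. a = complex_of_real r \<and> 0 \<le> r \<and> r \<le> 2 * real (max_degree N adj)"
proof -
  let ?A = "map_mat complex_of_real (laplacian N adj)"
  define w :: "nat \<Rightarrow> nat \<Rightarrow> real" where "w i j = (if adj i j then 1 else 0)" for i j
  define d where "d i = real (vdegree N adj i)" for i
  have wsym: "w i j = w j i" for i j
    using G by (auto simp: w_def simple_graph_def)
  have w0: "0 \<le> w i j" for i j by (simp add: w_def)
  have d: "d i = (\<Sum>j<N. w i j)" for i by (simp add: d_def w_def vdegree_sum)
  have dle: "d i \<le> max_degree N adj" if "i < N" for i
    using vdegree_le_max_degree[OF that] by (simp add: d_def)
  from ev obtain v where v: "v \<in> carrier_vec N" "v \<noteq> 0\<^sub>v N" "?A *\<^sub>v v = a \<cdot>\<^sub>v v"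
    by (auto simp: eigenvalue_def eigenvector_def laplacian_def)
  define f where "f i = vec_index v i" for i
  define S where "S = (\<Sum>i<N. (cmod (f i))\<^sup>2)"
  \<comment> \<open>The sum runs over ordered pairs and meets each edge twice; hence the Rayleigh
    quotient appears below as \<open>Q / (2 * S)\<close>.\<close>
  define Q where "Q = (\<Sum>i<N. \<Sum>j<N. w i j * (cmod (f i - f j))\<^sup>2)"
  have eq: "a * f i = of_real (d i) * f i - (\<Sum>j<N. of_real (w i j) * f j)" if i: "i < N" for i
  proof -
    have "a * f i = vec_index (?A *\<^sub>v v) i" using v i by (simp add: f_def)
    also have "\<dots> = (\<Sum>j<N. of_real ((if i = j then d i else 0) - w i j) * f j)"
      using v(1) i
      by (auto simp: laplacian_def scalar_prod_def atLeast0LessThan f_def d_def w_def intro!: sum.cong)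
    also have "\<dots> = (\<Sum>j<N. (if i = j then of_real (d i) * f j else 0) - of_real (w i j) * f j)"
      by (intro sum.cong) (auto simp: algebra_simps)
    also have "\<dots> = of_real (d i) * f i - (\<Sum>j<N. of_real (w i j) * f j)"
      using i by (simp add: sum_subtractf)
    finally show ?thesis .
  qed
  have Spos: "S > 0"
  proof -
    obtain i where "i < N" "f i \<noteq> 0"
    proof (rule ccontr)
      assume "\<not> thesis"
      with that have "vec_index v i = 0" if "i < N" for i using that by (auto simp: f_def)
      with v(1) have "v = 0\<^sub>v N" by (intro eq_vecI) auto
      with v(2) show False by contradiction
    qed
    then show ?thesis unfolding S_def by (intro sum_pos2[of _ i]) auto
  qed
  have nf: "cnj z * z = of_real ((cmod z)\<^sup>2)" for z
    unfolding complex_norm_square by (rule mult.commute)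
  \<comment> \<open>Pairing the eigenvector equation with the conjugate of \<open>f\<close>
    expresses \<open>a * S\<close> as a degree term minus an adjacency term. Expanding the squares
    in \<open>Q\<close> gives twice that difference, by symmetry of \<open>w\<close>.\<close>
  have "(\<Sum>i<N. cnj (f i) * (a * f i)) =
      (\<Sum>i<N. of_real (d i) * of_real ((cmod (f i))\<^sup>2)) - (\<Sum>i<N. \<Sum>j<N. of_real (w i j) * (cnj (f i) * f j))"
    (is "?l = ?D - ?W")
    unfolding nf[symmetric] sum_subtractf[symmetric]
    by (intro sum.cong refl) (simp add: eq right_diff_distrib sum_distrib_left mult_ac)
  moreover have "?l = a * of_real S"
    unfolding S_def of_real_sum nf[symmetric] sum_distrib_left by (simp add: mult_ac)
  ultimately have aS: "a * of_real S = ?D - ?W" by simp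
  have D1: "(\<Sum>i<N. \<Sum>j<N. w i j * g i) = (\<Sum>i<N. d i * g i)" for g :: "nat \<Rightarrow> real"
    by (simp add: d sum_distrib_right)
  have D2: "(\<Sum>i<N. \<Sum>j<N. w i j * g j) = (\<Sum>i<N. d i * g i)" for g :: "nat \<Rightarrow> real"
    by (subst sum.swap, subst wsym) (rule D1)
  have W2: "(\<Sum>i<N. \<Sum>j<N. of_real (w i j) * (f i * cnj (f j))) = ?W"
    by (subst sum.swap, subst wsym) (simp add: mult_ac)
  have sq: "of_real ((cmod (x - y))\<^sup>2) = of_real ((cmod x)\<^sup>2) + of_real ((cmod y)\<^sup>2) - cnj x * y - x * cnj y" for x y
    unfolding complex_norm_square complex_cnj_diff by (simp add: algebra_simps)
  have "complex_of_real Q = (\<Sum>i<N. \<Sum>j<N. of_real (w i j * (cmod (f i))\<^sup>2) + of_real (w i j * (cmod (f j))\<^sup>2)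
      - of_real (w i j) * (cnj (f i) * f j) - of_real (w i j) * (f i * cnj (f j)))"
    unfolding Q_def of_real_sum of_real_mult sq by (intro sum.cong refl) (simp add: algebra_simps)
  also have "\<dots> = of_real (\<Sum>i<N. \<Sum>j<N. w i j * (cmod (f i))\<^sup>2) + of_real (\<Sum>i<N. \<Sum>j<N. w i j * (cmod (f j))\<^sup>2)
      - ?W - (\<Sum>i<N. \<Sum>j<N. of_real (w i j) * (f i * cnj (f j)))"
    by (simp add: sum.distrib sum_subtractf)
  also have "\<dots> = 2 * (?D - ?W)"
    unfolding D1 D2 W2 by simp
  finally have "of_real Q = 2 * (a * of_real S)" by (simp add: aS)
  then have a: "a = of_real (Q / (2 * S))"
    using Spos by (simp add: field_simps)
  have "0 \<le> Q" unfolding Q_def by (intro sum_nonneg mult_nonneg_nonneg w0) auto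
  moreover have "Q \<le> 2 * max_degree N adj * (2 * S)"
  proof -
    \<comment> \<open>With this bound both endpoints contribute equally, so \<open>Q\<close> is at
      most four times the degree-weighted norm of \<open>f\<close>, and \<open>Q / (2 * S)\<close>
      at most twice the maximum degree.\<close>
    have par: "(cmod (x - y))\<^sup>2 \<le> 2 * (cmod x)\<^sup>2 + 2 * (cmod y)\<^sup>2" for x y
    proof -
      have "(cmod (x - y))\<^sup>2 \<le> (cmod x + cmod y)\<^sup>2"
        by (intro power_mono norm_triangle_ineq4) auto
      also have "\<dots> \<le> 2 * (cmod x)\<^sup>2 + 2 * (cmod y)\<^sup>2"
        using sum_squares_bound[of "cmod x" "cmod y"] by (simp add: power2_sum)
      finally show ?thesis .
    qed
    have "Q \<le> (\<Sum>i<N. \<Sum>j<N. w i j * (2 * (cmod (f i))\<^sup>2 + 2 * (cmod (f j))\<^sup>2))"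
      unfolding Q_def by (intro sum_mono mult_left_mono par w0)
    also have "\<dots> = 4 * (\<Sum>i<N. d i * (cmod (f i))\<^sup>2)"
      using D1[of "\<lambda>i. 2 * (cmod (f i))\<^sup>2"] D2[of "\<lambda>i. 2 * (cmod (f i))\<^sup>2"]
      by (simp add: distrib_left sum.distrib sum_distrib_left mult_ac)
    also have "\<dots> \<le> 4 * (\<Sum>i<N. max_degree N adj * (cmod (f i))\<^sup>2)"
      by (intro mult_left_mono sum_mono mult_right_mono dle) auto
    also have "\<dots> = 2 * max_degree N adj * (2 * S)"
      by (simp add: S_def sum_distrib_left)
    finally show ?thesis .
  qed
  ultimately show ?thesis
    using Spos a by (intro exI[of _ "Q / (2 * S)"]) (simp add: divide_le_eq)
qed

text \<open>The characteristic polynomial splits over the complex numbers and all its roots are real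
  by \<open>laplacian_eigenvalue\<close>; injectivity of the embedding pulls the factorization back
  to the reals. The trace is the degree sum.\<close>

lemma laplacian_spectrum:
  assumes G: "simple_graph N adj"
  obtains ls where "length ls = N" "\<And>l. l \<in> set ls \<Longrightarrow> 0 \<le> l \<and> l \<le> 2 * real (max_degree N adj)"
    "sum_list ls = 2 * real (num_edges N adj)"
    "char_poly (laplacian N adj) = (\<Prod>l\<leftarrow>ls. [:- l, 1:])"
proof -
  let ?A = "map_mat complex_of_real (laplacian N adj)"
  have L: "laplacian N adj \<in> carrier_mat N N" by (simp add: laplacian_def)
  then have A: "?A \<in> carrier_mat N N" by simp
  from char_poly_factorized[OF A] obtain as where
    cp: "char_poly ?A = (\<Prod>a\<leftarrow>as. [:- a, 1:])" and len: "length as = N" by blast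
  have "\<exists>r. a = complex_of_real r \<and> 0 \<le> r \<and> r \<le> 2 * real (max_degree N adj)" if "a \<in> set as" for a
  proof (rule laplacian_eigenvalue[OF G])
    show "eigenvalue ?A a"
      unfolding eigenvalue_root_char_poly[OF A] cp poly_prod_list prod_list_zero_iff
      using that by (auto simp: image_iff intro!: bexI[of _ a])
  qed
  then have a: "complex_of_real (Re a) = a \<and> 0 \<le> Re a \<and> Re a \<le> 2 * real (max_degree N adj)"
    if "a \<in> set as" for a
    using that by fastforce
  define ls where "ls = map Re as"
  have as: "as = map complex_of_real ls"
    using a by (simp add: ls_def map_idI)
  interpret h: map_poly_inj_comm_ring_hom complex_of_real ..
  have "map_poly complex_of_real (char_poly (laplacian N adj)) = (\<Prod>a\<leftarrow>as. [:- a, 1:])"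
    unfolding cp[symmetric] by (rule of_real_hom.char_poly_hom[OF L, symmetric])
  also have "\<dots> = map_poly complex_of_real (\<Prod>l\<leftarrow>ls. [:- l, 1:])"
    by (simp add: as h.hom_prod_list o_def)
  finally have cpl: "char_poly (laplacian N adj) = (\<Prod>l\<leftarrow>ls. [:- l, 1:])"
    by simp
  \<comment> \<open>Without loops the adjacency part contributes nothing to the diagonal, which
    therefore consists of the degrees.\<close>
  have irrefl: "\<not> adj i i" for i using G unfolding simple_graph_def by blast
  have "complex_of_real (sum_list ls) = sum_list as"
    unfolding as by (induction ls) auto
  also have "\<dots> = (\<Sum>i<N. ?A $$ (i, i))"
    by (rule trace_eq_sum_roots[OF A cp, symmetric])
  also have "\<dots> = of_real (\<Sum>i<N. vdegree N adj i)"
    by (simp add: laplacian_def irrefl)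
  also have "\<dots> = of_real (2 * real (num_edges N adj))"
    unfolding handshake[OF G] by simp
  finally have "sum_list ls = 2 * real (num_edges N adj)"
    unfolding of_real_eq_iff .
  then show ?thesis
    using that[of ls] cpl a len by (auto simp: ls_def)
qed

section \<open>Sums of independent Bernoulli variables\<close>

text \<open>\<open>bern_weight ps k\<close> is the probability that independent Bernoulli variables with success
  probabilities \<open>ps\<close> have sum \<open>k\<close>, that is, the coefficient of \<open>x ^ k\<close> in \<open>\<Prod>(1 - p + p * x)\<close>.\<close>

fun bern_weight :: "real list \<Rightarrow> nat \<Rightarrow> real" where
  "bern_weight [] k = (if k = 0 then 1 else 0)"
| "bern_weight (p # ps) k =
     (1 - p) * bern_weight ps k + (case k of 0 \<Rightarrow> 0 | Suc j \<Rightarrow> p * bern_weight ps j)"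

definition bern_var :: "real list \<Rightarrow> real" where
  "bern_var ps = (\<Sum>p\<leftarrow>ps. p * (1 - p))"

lemma bern_var_simps [simp]: "bern_var [] = 0" "bern_var (p # ps) = p * (1 - p) + bern_var ps"
  by (simp_all add: bern_var_def)

lemma bern_var_nonneg: "set ps \<subseteq> {0..1} \<Longrightarrow> 0 \<le> bern_var ps"
  by (induction ps) auto

lemma bern_weight_eq_0: "length ps < k \<Longrightarrow> bern_weight ps k = 0"
  by (induction ps k rule: bern_weight.induct) (auto split: nat.splits)

lemma bern_weight_nonneg: "set ps \<subseteq> {0..1} \<Longrightarrow> 0 \<le> bern_weight ps k"
  by (induction ps k rule: bern_weight.induct) (auto split: nat.splits)

text \<open>Values in a real vector space let one functional serve both the real moments and the
  complex exponentials.\<close>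

definition bern_expect :: "real list \<Rightarrow> (nat \<Rightarrow> 'a::real_vector) \<Rightarrow> 'a" where
  "bern_expect ps f = (\<Sum>k\<le>length ps. bern_weight ps k *\<^sub>R f k)"

lemma bern_expect_Nil [simp]: "bern_expect [] f = f 0"
  by (simp add: bern_expect_def)

text \<open>Conditioning on the first variable: a success shifts the sum of the others by one. The
  moment and characteristic function computations are inductions on this recursion.\<close>

lemma bern_expect_Cons:
  "bern_expect (p # ps) f = (1 - p) *\<^sub>R bern_expect ps f + p *\<^sub>R bern_expect ps (\<lambda>k. f (Suc k))"
proof -
  let ?n = "length ps"
  have "bern_expect (p # ps) f =
      (\<Sum>k\<le>Suc ?n. (1 - p) *\<^sub>R bern_weight ps k *\<^sub>R f k)
      + (\<Sum>k\<le>Suc ?n. (case k of 0 \<Rightarrow> 0 | Suc j \<Rightarrow> p * bern_weight ps j) *\<^sub>R f k)"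
    by (simp add: bern_expect_def sum.distrib[symmetric] scaleR_add_left del: sum.atMost_Suc)
  also have "(\<Sum>k\<le>Suc ?n. (1 - p) *\<^sub>R bern_weight ps k *\<^sub>R f k) = (1 - p) *\<^sub>R bern_expect ps f"
    by (simp add: bern_expect_def scaleR_sum_right bern_weight_eq_0 del: scaleR_scaleR)
  also have "(\<Sum>k\<le>Suc ?n. (case k of 0 \<Rightarrow> 0 | Suc j \<Rightarrow> p * bern_weight ps j) *\<^sub>R f k)
      = p *\<^sub>R bern_expect ps (\<lambda>k. f (Suc k))"
    by (simp add: bern_expect_def scaleR_sum_right sum.atMost_Suc_shift del: sum.atMost_Suc)
  finally show ?thesis .
qed

section \<open>Moments and characteristic function of the Bernoulli sum\<close>

lemma bern_expect_add: "bern_expect ps (\<lambda>k. f k + g k) = bern_expect ps f + bern_expect ps g"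
  by (simp add: bern_expect_def scaleR_add_right sum.distrib)

lemma bern_expect_diff: "bern_expect ps (\<lambda>k. f k - g k) = bern_expect ps f - bern_expect ps g"
  by (simp add: bern_expect_def scaleR_diff_right sum_subtractf)

lemma bern_expect_cmult:
  "bern_expect ps (\<lambda>k. c * f k) = c * bern_expect ps (f :: nat \<Rightarrow> 'a :: real_algebra)"
  by (simp add: bern_expect_def sum_distrib_left)

lemma bern_expect_const: "bern_expect ps (\<lambda>_. c) = c"
  by (induction ps) (simp_all add: bern_expect_Cons scaleR_add_left[symmetric])

lemma bern_expect_mean: "bern_expect ps real = sum_list ps"
  by (induction ps) (simp_all add: bern_expect_Cons bern_expect_add bern_expect_const algebra_simps)

lemma bern_expect_square: "bern_expect ps (\<lambda>k. (real k)\<^sup>2) = (sum_list ps)\<^sup>2 + bern_var ps"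
proof (induction ps)
  case (Cons p ps)
  have "bern_expect ps (\<lambda>k. (real (Suc k))\<^sup>2) = bern_expect ps (\<lambda>k. (real k)\<^sup>2 + (2 * real k + 1))"
    by (simp add: power2_eq_square algebra_simps)
  also have "\<dots> = (sum_list ps)\<^sup>2 + bern_var ps + (2 * sum_list ps + 1)"
    by (simp only: bern_expect_add bern_expect_cmult bern_expect_const bern_expect_mean Cons.IH)
  finally show ?case
    unfolding bern_expect_Cons Cons.IH by (simp add: power2_eq_square algebra_simps)
qed simp

lemma bern_expect_variance: "bern_expect ps (\<lambda>k. (real k - sum_list ps)\<^sup>2) = bern_var ps"
proof -
  let ?m = "sum_list ps"
  have "bern_expect ps (\<lambda>k. (real k - ?m)\<^sup>2)
      = bern_expect ps (\<lambda>k. (real k)\<^sup>2 + (?m\<^sup>2 - (2 * ?m) * real k))"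
    by (simp add: power2_diff algebra_simps)
  also have "\<dots> = bern_var ps"
    unfolding bern_expect_add bern_expect_diff bern_expect_cmult bern_expect_const
      bern_expect_mean bern_expect_square by (simp add: power2_eq_square)
  finally show ?thesis .
qed

text \<open>The characteristic function at \<open>u\<close> of one centred Bernoulli variable, which
  takes the values \<open>- p\<close> and \<open>1 - p\<close>.\<close>

definition bern_factor :: "real \<Rightarrow> real \<Rightarrow> complex" where
  "bern_factor u p = of_real (1 - p) * iexp (- (u * p)) + of_real p * iexp (u * (1 - p))"

lemma bern_expect_iexp:
  "bern_expect ps (\<lambda>k. iexp (u * (real k - sum_list ps))) = (\<Prod>p\<leftarrow>ps. bern_factor u p)"
proof (induction ps)
  case (Cons p ps)
  let ?f = "\<lambda>k. iexp (u * (real k - sum_list ps))"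
  have "bern_expect (p # ps) (\<lambda>k. iexp (u * (real k - sum_list (p # ps))))
      = (1 - p) *\<^sub>R bern_expect ps (\<lambda>k. iexp (- (u * p)) * ?f k)
        + p *\<^sub>R bern_expect ps (\<lambda>k. iexp (u * (1 - p)) * ?f k)"
    unfolding bern_expect_Cons
    by (intro arg_cong2[where f = plus] arg_cong[where f = "scaleR _"] arg_cong[where f = "bern_expect ps"] ext)
       (simp_all add: exp_add[symmetric] algebra_simps)
  then show ?case
    unfolding bern_expect_cmult Cons.IH
    by (simp add: bern_factor_def[of u p] scaleR_conv_of_real algebra_simps)
qed simp

section \<open>Gaussian upper bound for the characteristic function\<close>

lemma jordan_sin_ge:
  assumes "0 \<le> x" "x \<le> pi / 2"
  shows "2 * x / pi \<le> sin x"
proof -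
  \<comment> \<open>Concavity of the sine puts its graph above the chord from 0 to \<pi>/2.\<close>
  have "convex_on {0..pi / 2} (\<lambda>x. - sin x)"
    by (rule f''_ge0_imp_convex[where f' = "\<lambda>x. - cos x" and f'' = sin])
       (auto intro!: derivative_eq_intros sin_ge_zero)
  from convex_onD[OF this, of "2 * x / pi" 0 "pi / 2"] assms
  show ?thesis by (simp add: field_simps)
qed

text \<open>The half-angle formula reduces this to Jordan's inequality. The quadratic bound covers a
  full period, which is the range that Fourier inversion needs.\<close>

lemma one_minus_cos_ge:
  assumes "\<bar>u\<bar> \<le> pi"
  shows "2 * u\<^sup>2 / pi\<^sup>2 \<le> 1 - cos u"
proof -
  have "2 * (\<bar>u\<bar> / 2) / pi \<le> sin (\<bar>u\<bar> / 2)"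
    using assms by (intro jordan_sin_ge) auto
  then have "(\<bar>u\<bar> / pi)\<^sup>2 \<le> (sin (\<bar>u\<bar> / 2))\<^sup>2"
    by (intro power_mono) auto
  moreover have "cos u = 1 - 2 * (sin (\<bar>u\<bar> / 2))\<^sup>2"
    using cos_double_sin[of "\<bar>u\<bar> / 2"] by simp
  ultimately show ?thesis by (simp add: power_divide)
qed

text \<open>The squared modulus equals \<open>1 - 2 * (p * (1 - p) * (1 - cos u))\<close>, to which
  \<open>1 + x \<le> exp x\<close> applies.\<close>

lemma norm_bern_factor_le:
  assumes "0 \<le> p" "p \<le> 1"
  shows "cmod (bern_factor u p) \<le> exp (- (p * (1 - p) * (1 - cos u)))"
proof -
  have "bern_factor u p = iexp (- (u * p)) * (of_real (1 - p) + of_real p * iexp u)"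
    by (simp add: bern_factor_def exp_add[symmetric] algebra_simps)
  then have "cmod (bern_factor u p) = cmod (of_real (1 - p) + of_real p * iexp u)"
    by (simp add: norm_mult)
  also have "\<dots>\<^sup>2 = (1 - p + p * cos u)\<^sup>2 + (p * sin u)\<^sup>2"
    by (simp add: cmod_power2 cis_conv_exp[symmetric])
  also have "\<dots> = (1 - p)\<^sup>2 + 2 * (p * (1 - p)) * cos u + p\<^sup>2 * ((sin u)\<^sup>2 + (cos u)\<^sup>2)"
    by (simp add: power2_eq_square algebra_simps
             del: sin_cos_squared_add sin_cos_squared_add2 sin_cos_squared_add3)
  also have "\<dots> = 1 + (- 2 * (p * (1 - p) * (1 - cos u)))"
    unfolding sin_cos_squared_add by (simp add: power2_eq_square algebra_simps)
  also have "\<dots> \<le> exp (- 2 * (p * (1 - p) * (1 - cos u)))"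
    by (rule exp_ge_add_one_self)
  also have "\<dots> = (exp (- (p * (1 - p) * (1 - cos u))))\<^sup>2"
    by (simp add: exp_double[symmetric])
  finally show ?thesis by (rule power2_le_imp_le) simp
qed

lemma norm_bern_factor_le_1:
  assumes "0 \<le> p" "p \<le> 1"
  shows "cmod (bern_factor u p) \<le> 1"
  using norm_bern_factor_le[OF assms, of u] assms
  by (auto intro: order_trans simp: mult_nonneg_nonneg)

lemma norm_bern_prod_le:
  assumes "set ps \<subseteq> {0..1}" "\<bar>u\<bar> \<le> pi"
  shows "cmod (\<Prod>p\<leftarrow>ps. bern_factor u p) \<le> exp (- (2 * u\<^sup>2 / pi\<^sup>2 * bern_var ps))"
  using assms(1)
proof (induction ps)
  case (Cons p ps)
  then have p: "0 \<le> p" "p \<le> 1" by auto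
  have "cmod (bern_factor u p) \<le> exp (- (p * (1 - p) * (1 - cos u)))"
    using p by (rule norm_bern_factor_le)
  also have "\<dots> \<le> exp (- (2 * u\<^sup>2 / pi\<^sup>2 * (p * (1 - p))))"
    using mult_left_mono[OF one_minus_cos_ge[OF assms(2)], of "p * (1 - p)"] p
    by (simp add: mult.commute)
  finally have "cmod (bern_factor u p) * cmod (\<Prod>p\<leftarrow>ps. bern_factor u p)
      \<le> exp (- (2 * u\<^sup>2 / pi\<^sup>2 * (p * (1 - p)))) * exp (- (2 * u\<^sup>2 / pi\<^sup>2 * bern_var ps))"
    using Cons by (intro mult_mono) auto
  then show ?case
    by (simp add: norm_mult exp_add[symmetric] algebra_simps add_divide_distrib diff_divide_distrib)
qed simp

section \<open>Taylor comparison with the Gaussian\<close>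

lemma exp_minus_approx:
  assumes "0 \<le> (y::real)"
  shows "\<bar>exp (- y) - (1 - y)\<bar> \<le> y\<^sup>2 / 2"
proof -
  have "exp (- y) \<le> 1 - y + y\<^sup>2 / 2"
  proof -
    have "\<exists>t. \<bar>t\<bar> \<le> \<bar>- y\<bar> \<and> exp (- y) = (\<Sum>m<3. (- y) ^ m / fact m) + exp t / fact 3 * (- y) ^ 3"
      by (rule Maclaurin_exp_le)
    then obtain t where "exp (- y) = (\<Sum>m<3. (- y) ^ m / fact m) + exp t / fact 3 * (- y) ^ 3"
      by blast
    moreover have "exp t / fact 3 * (- y) ^ 3 \<le> 0"
      using assms by (simp add: divide_le_0_iff)
    ultimately show ?thesis
      by (simp add: numeral_3_eq_3 eval_nat_numeral)
  qed
  moreover have "1 - y \<le> exp (- y)" using exp_ge_add_one_self[of "- y"] by simp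
  ultimately show ?thesis by (auto simp: abs_le_iff)
qed

text \<open>Centring cancels the linear terms, so both functions agree with
  \<open>1 - u\<^sup>2 / 2 * (p * (1 - p))\<close> to second order. The third absolute moment is at
  most \<open>p * (1 - p)\<close>; keeping this factor in the error makes the errors add up to a
  multiple of the variance.\<close>

lemma bern_factor_approx:
  assumes p: "0 \<le> p" "p \<le> 1"
  shows "cmod (bern_factor u p - of_real (exp (- (u\<^sup>2 / 2 * (p * (1 - p))))))
    \<le> (\<bar>u\<bar> ^ 3 / 6 + u ^ 4 / 8) * (p * (1 - p))"
proof -
  let ?v = "p * (1 - p)"
  have v: "0 \<le> ?v" "?v \<le> 1" using p by (auto simp: mult_le_one)
  define R where "R x = iexp x - (1 + \<i> * of_real x - of_real (x\<^sup>2 / 2))" for x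
  have R: "cmod (R x) \<le> \<bar>x\<bar> ^ 3 / 6" for x
    using iexp_approx1[of x 2] unfolding R_def
    by (simp add: eval_nat_numeral power2_eq_square algebra_simps)
  have eq: "bern_factor u p - of_real (1 - u\<^sup>2 / 2 * ?v)
      = of_real (1 - p) * R (- (u * p)) + of_real p * R (u * (1 - p))"
    unfolding bern_factor_def R_def by (simp add: field_simps power2_eq_square)
  have "cmod (of_real (1 - p) * R (- (u * p)) + of_real p * R (u * (1 - p)))
      \<le> (1 - p) * cmod (R (- (u * p))) + p * cmod (R (u * (1 - p)))"
    using p by (intro order_trans[OF norm_triangle_ineq]) (simp add: norm_mult del: of_real_diff)
  also have "\<dots> \<le> (1 - p) * (\<bar>- (u * p)\<bar> ^ 3 / 6) + p * (\<bar>u * (1 - p)\<bar> ^ 3 / 6)"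
    using p by (intro add_mono mult_left_mono R) auto
  also have "\<dots> = \<bar>u\<bar> ^ 3 / 6 * ?v * (p\<^sup>2 + (1 - p)\<^sup>2)"
  proof -
    have "\<bar>- (u * p)\<bar> = \<bar>u\<bar> * p" "\<bar>u * (1 - p)\<bar> = \<bar>u\<bar> * (1 - p)"
      using p by (simp_all add: abs_mult)
    then show ?thesis
      by (simp only: power_mult_distrib) (simp add: eval_nat_numeral field_simps)
  qed
  also have "\<dots> \<le> \<bar>u\<bar> ^ 3 / 6 * ?v * 1"
  proof (rule mult_left_mono)
    show "p\<^sup>2 + (1 - p)\<^sup>2 \<le> 1" using v(1) by (simp add: power2_eq_square algebra_simps)
    show "0 \<le> \<bar>u\<bar> ^ 3 / 6 * ?v" using v(1) by simp
  qed
  finally have 1: "cmod (bern_factor u p - of_real (1 - u\<^sup>2 / 2 * ?v)) \<le> \<bar>u\<bar> ^ 3 / 6 * ?v"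
    unfolding eq by simp
  have "\<bar>exp (- (u\<^sup>2 / 2 * ?v)) - (1 - u\<^sup>2 / 2 * ?v)\<bar> \<le> (u\<^sup>2 / 2 * ?v)\<^sup>2 / 2"
    using v by (intro exp_minus_approx) auto
  also have "\<dots> = u ^ 4 / 8 * ?v * ?v"
    by (simp add: power2_eq_square eval_nat_numeral)
  also have "\<dots> \<le> u ^ 4 / 8 * ?v * 1"
    using v by (intro mult_left_mono) auto
  finally have 2: "cmod (of_real (1 - u\<^sup>2 / 2 * ?v) - of_real (exp (- (u\<^sup>2 / 2 * ?v)))) \<le> u ^ 4 / 8 * ?v"
    unfolding of_real_diff[symmetric] norm_of_real by (simp add: abs_minus_commute)
  from norm_triangle_le[OF add_mono[OF 1 2]] show ?thesis
    by (simp add: algebra_simps)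
qed

text \<open>Telescoping: the factors are exchanged one at a time, and all remaining factors have
  norm at most 1.\<close>

lemma norm_prod_list_diff_le:
  fixes f g :: "'a \<Rightarrow> 'b :: {real_normed_algebra_1, comm_monoid_mult}"
  assumes "\<And>x. x \<in> set xs \<Longrightarrow> norm (f x) \<le> 1" "\<And>x. x \<in> set xs \<Longrightarrow> norm (g x) \<le> 1"
  shows "norm ((\<Prod>x\<leftarrow>xs. f x) - (\<Prod>x\<leftarrow>xs. g x)) \<le> (\<Sum>x\<leftarrow>xs. norm (f x - g x))"
  using assms
proof (induction xs)
  case (Cons x xs)
  have n1: "norm (\<Prod>x\<leftarrow>xs. f x) \<le> 1" if "\<forall>x\<in>set xs. norm (f x) \<le> 1" for xs
    using that
  proof (induction xs)
    case (Cons y ys)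
    then show ?case
      using norm_mult_ineq[of "f y" "\<Prod>x\<leftarrow>ys. f x"] mult_le_one[of "norm (f y)" "norm (\<Prod>x\<leftarrow>ys. f x)"]
      by auto
  qed simp
  have "f x * (\<Prod>x\<leftarrow>xs. f x) - g x * (\<Prod>x\<leftarrow>xs. g x)
      = (f x - g x) * (\<Prod>x\<leftarrow>xs. f x) + g x * ((\<Prod>x\<leftarrow>xs. f x) - (\<Prod>x\<leftarrow>xs. g x))"
    by (simp add: algebra_simps)
  also have "norm \<dots> \<le> norm (f x - g x) * norm (\<Prod>x\<leftarrow>xs. f x)
      + norm (g x) * norm ((\<Prod>x\<leftarrow>xs. f x) - (\<Prod>x\<leftarrow>xs. g x))"
    by (intro order_trans[OF norm_triangle_ineq] add_mono norm_mult_ineq)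
  also have "\<dots> \<le> norm (f x - g x) * 1 + 1 * (\<Sum>x\<leftarrow>xs. norm (f x - g x))"
    using Cons by (intro add_mono mult_mono n1) auto
  finally show ?case by simp
qed simp

lemma bern_prod_approx:
  assumes "set ps \<subseteq> {0..1}"
  shows "cmod ((\<Prod>p\<leftarrow>ps. bern_factor u p) - of_real (exp (- (u\<^sup>2 / 2 * bern_var ps))))
    \<le> (\<bar>u\<bar> ^ 3 / 6 + u ^ 4 / 8) * bern_var ps"
proof -
  let ?g = "\<lambda>p. complex_of_real (exp (- (u\<^sup>2 / 2 * (p * (1 - p)))))"
  have p: "0 \<le> p \<and> p \<le> 1" if "p \<in> set ps" for p using that assms by auto
  have "of_real (exp (- (u\<^sup>2 / 2 * bern_var ps))) = (\<Prod>p\<leftarrow>ps. ?g p)"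
  proof (induction ps)
    case (Cons p ps)
    have "exp (- (u\<^sup>2 / 2 * bern_var (p # ps)))
        = exp (- (u\<^sup>2 / 2 * (p * (1 - p)))) * exp (- (u\<^sup>2 / 2 * bern_var ps))"
      unfolding exp_add[symmetric] bern_var_simps by (simp add: field_simps)
    with Cons show ?case by simp
  qed simp
  then have "cmod ((\<Prod>p\<leftarrow>ps. bern_factor u p) - of_real (exp (- (u\<^sup>2 / 2 * bern_var ps))))
      \<le> (\<Sum>p\<leftarrow>ps. cmod (bern_factor u p - ?g p))"
    using p by (auto intro!: norm_prod_list_diff_le norm_bern_factor_le_1 simp: norm_of_real)
  also have "\<dots> \<le> (\<Sum>p\<leftarrow>ps. (\<bar>u\<bar> ^ 3 / 6 + u ^ 4 / 8) * (p * (1 - p)))"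
    using p by (intro sum_list_mono bern_factor_approx) auto
  also have "\<dots> = (\<bar>u\<bar> ^ 3 / 6 + u ^ 4 / 8) * bern_var ps"
    by (simp add: bern_var_def sum_list_const_mult)
  finally show ?thesis .
qed

section \<open>The local limit theorem\<close>

definition bern_sd :: "real list \<Rightarrow> real" where
  "bern_sd ps = sqrt (bern_var ps)"

text \<open>Extended by zero to the integers, since the local limit theorem evaluates it at a floor
  that may be negative.\<close>

definition bern_prob :: "real list \<Rightarrow> int \<Rightarrow> real" where
  "bern_prob ps k = (if 0 \<le> k then bern_weight ps (nat k) else 0)"

definition bern_char :: "real list \<Rightarrow> real \<Rightarrow> complex" where
  "bern_char ps s = bern_expect ps (\<lambda>k. iexp (s * ((real k - sum_list ps) / bern_sd ps)))"

lemma bern_sd_nonneg: "set ps \<subseteq> {0..1} \<Longrightarrow> 0 \<le> bern_sd ps"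
  by (simp add: bern_sd_def bern_var_nonneg)

lemma bern_sd_square: "set ps \<subseteq> {0..1} \<Longrightarrow> (bern_sd ps)\<^sup>2 = bern_var ps"
  by (simp add: bern_sd_def bern_var_nonneg)

lemma bern_char_eq_prod: "bern_char ps s = (\<Prod>p\<leftarrow>ps. bern_factor (s / bern_sd ps) p)"
  unfolding bern_char_def bern_expect_iexp[symmetric] by simp

lemma bern_char_measurable [measurable]: "bern_char ps \<in> borel_measurable borel"
  unfolding bern_char_def[abs_def] bern_expect_def by measurable

lemma norm_bern_char_le:
  assumes ps: "set ps \<subseteq> {0..1}" and s: "\<bar>s\<bar> \<le> pi * bern_sd ps"
  shows "cmod (bern_char ps s) \<le> exp (- (2 * s\<^sup>2 / pi\<^sup>2))"
proof (cases "bern_sd ps = 0")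
  \<comment> \<open>Here the hypothesis forces \<open>s = 0\<close> and the bound is 1. Covering
    this degenerate case lets the domination hold for every index of a sequence.\<close>
  case True
  with s show ?thesis
    using norm_bern_prod_le[OF ps, of 0] by (simp add: bern_char_eq_prod)
next
  case False
  with bern_sd_nonneg[OF ps] have pos: "0 < bern_sd ps" by simp
  have "\<bar>s / bern_sd ps\<bar> \<le> pi"
    using s pos by (simp add: field_simps)
  from norm_bern_prod_le[OF ps this] show ?thesis
    using pos by (simp add: bern_char_eq_prod bern_sd_square[OF ps, symmetric] power_divide)
qed

text \<open>Rescaling \<open>u = s / bern_sd ps\<close> turns the cubic error times the variance
  into a term of order 1/\<sigma>, and the quartic one into order 1/\<sigma>^2.\<close>

lemma bern_char_approx:
  assumes ps: "set ps \<subseteq> {0..1}" and pos: "0 < bern_sd ps"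
  shows "cmod (bern_char ps s - of_real (exp (- s\<^sup>2 / 2)))
    \<le> \<bar>s\<bar> ^ 3 / 6 / bern_sd ps + s ^ 4 / 8 / (bern_sd ps)\<^sup>2"
proof -
  let ?u = "s / bern_sd ps"
  have "- (?u\<^sup>2 / 2 * (bern_sd ps)\<^sup>2) = - s\<^sup>2 / 2"
    using pos by (simp add: power_divide)
  moreover have "(\<bar>?u\<bar> ^ 3 / 6 + ?u ^ 4 / 8) * (bern_sd ps)\<^sup>2
      = \<bar>s\<bar> ^ 3 / 6 / bern_sd ps + s ^ 4 / 8 / (bern_sd ps)\<^sup>2"
    using pos by (simp add: abs_divide power_divide field_simps eval_nat_numeral)
  ultimately show ?thesis
    using bern_prod_approx[OF ps, of ?u]
    unfolding bern_char_eq_prod bern_sd_square[OF ps, symmetric] by simp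
qed

lemma bern_char_tendsto:
  assumes ps: "\<And>n. set (ps n) \<subseteq> {0..1}"
    and sd: "filterlim (\<lambda>n. bern_sd (ps n)) at_top sequentially"
  shows "(\<lambda>n. bern_char (ps n) s) \<longlonglongrightarrow> of_real (exp (- s\<^sup>2 / 2))"
proof (rule Lim_transform[OF tendsto_const], rule Lim_null_comparison)
  show "\<forall>\<^sub>F n in sequentially. cmod (bern_char (ps n) s - of_real (exp (- s\<^sup>2 / 2)))
      \<le> \<bar>s\<bar> ^ 3 / 6 / bern_sd (ps n) + s ^ 4 / 8 / (bern_sd (ps n))\<^sup>2"
    using filterlim_at_top_dense[THEN iffD1, OF sd, rule_format, of 0]
    by eventually_elim (rule bern_char_approx[OF ps])
  have "filterlim (\<lambda>n. (bern_sd (ps n))\<^sup>2) at_top sequentially"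
    by (intro filterlim_pow_at_top sd) simp
  then show "(\<lambda>n. \<bar>s\<bar> ^ 3 / 6 / bern_sd (ps n) + s ^ 4 / 8 / (bern_sd (ps n))\<^sup>2) \<longlonglongrightarrow> 0"
    by (intro tendsto_add_zero tendsto_divide_0[OF tendsto_const] filterlim_at_top_imp_at_infinity sd)
qed

section \<open>Fourier inversion\<close>

lemma integral_iexp_Icc:
  assumes "0 \<le> a"
  shows "has_bochner_integral lborel (\<lambda>s. indicator {-a..a} s *\<^sub>R iexp (s * c))
    (of_real (if c = 0 then 2 * a else 2 * sin (a * c) / c))"
proof (cases "c = 0")
  case True
  have "has_bochner_integral lborel (\<lambda>s. indicator {-a..a} s *\<^sub>R (1::complex)) (of_real a - of_real (- a))"
    using assms
    by (intro has_bochner_integral_FTC_Icc) (auto intro!: derivative_eq_intros continuous_intros)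
  with True show ?thesis by simp
next
  case False
  have "has_bochner_integral lborel (\<lambda>s. indicator {-a..a} s *\<^sub>R iexp (s * c))
      (iexp (a * c) / (\<i> * c) - iexp (- a * c) / (\<i> * c))"
  proof (rule has_bochner_integral_FTC_Icc)
    fix x
    have "((\<lambda>s. iexp (s * c)) has_vector_derivative c *\<^sub>R (\<i> * iexp (x * c))) (at x within {-a..a})"
      by (rule vector_diff_chain_within[of "\<lambda>s. s * c" c x _ iexp, unfolded o_def])
         (auto intro!: derivative_eq_intros)
    then have "((\<lambda>s. iexp (s * c) * (1 / (\<i> * c))) has_vector_derivative
        c *\<^sub>R (\<i> * iexp (x * c)) * (1 / (\<i> * c))) (at x within {-a..a})"
      by (rule has_vector_derivative_mult_left)
    with False show "((\<lambda>s. iexp (s * c) / (\<i> * c)) has_vector_derivative iexp (x * c)) (at x within {-a..a})"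
      by (simp add: scaleR_conv_of_real)
  qed (use assms in \<open>auto intro!: continuous_intros\<close>)
  also have "iexp (a * c) / (\<i> * c) - iexp (- a * c) / (\<i> * c) = of_real (2 * sin (a * c) / c)"
    using False by (simp add: complex_eq_iff Re_divide Im_divide Re_exp Im_exp power2_eq_square field_simps)
  finally show ?thesis using False by simp
qed

text \<open>The standardised sum lives on a lattice of spacing 1/\<sigma>, so the interval from
  \<open>- a\<close> to \<open>a\<close> is one full period. By orthogonality only the exponential
  with \<open>int j = k\<close> survives, with integral \<open>2 * a\<close>.\<close>

lemma bern_prob_fourier:
  assumes ps: "set ps \<subseteq> {0..1}" and pos: "0 < bern_sd ps"
  defines "a \<equiv> pi * bern_sd ps"
  shows "has_bochner_integral lborel
    (\<lambda>s. indicator {-a..a} s *\<^sub>R (bern_char ps s * iexp (- s * ((real_of_int k - sum_list ps) / bern_sd ps))))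
    (of_real (2 * a * bern_prob ps k))"
proof -
  define d where "d j = (real j - real_of_int k) / bern_sd ps" for j
  have a: "0 \<le> a" using pos by (simp add: a_def)
  have int: "has_bochner_integral lborel (\<lambda>s. bern_weight ps j *\<^sub>R (indicator {-a..a} s *\<^sub>R iexp (s * d j)))
      (bern_weight ps j *\<^sub>R of_real (if int j = k then 2 * a else 0))" for j
  proof (rule has_bochner_integral_scaleR_right)
    have "sin (a * d j) = sin (pi * of_int (int j - k))"
      using pos by (simp add: a_def d_def)
    then have "sin (a * d j) = 0" by (simp only: sin_npi_int)
    moreover have "d j = 0 \<longleftrightarrow> int j = k"
      using pos by (auto simp: d_def)
    ultimately show "has_bochner_integral lborel (\<lambda>s. indicator {-a..a} s *\<^sub>R iexp (s * d j))
        (of_real (if int j = k then 2 * a else 0))"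
      using integral_iexp_Icc[OF a, of "d j"] by (simp split: if_splits)
  qed
  have "has_bochner_integral lborel
      (\<lambda>s. \<Sum>j\<le>length ps. bern_weight ps j *\<^sub>R (indicator {-a..a} s *\<^sub>R iexp (s * d j)))
      (\<Sum>j\<le>length ps. bern_weight ps j *\<^sub>R of_real (if int j = k then 2 * a else 0))"
    by (intro has_bochner_integral_sum int)
  also have "(\<Sum>j\<le>length ps. bern_weight ps j *\<^sub>R of_real (if int j = k then 2 * a else 0))
      = complex_of_real (2 * a * bern_prob ps k)"
  proof (cases "0 \<le> k")
    case True
    then have "int j = k \<longleftrightarrow> j = nat k" for j by auto
    then have "(\<Sum>j\<le>length ps. bern_weight ps j *\<^sub>R complex_of_real (if int j = k then 2 * a else 0))
        = (\<Sum>j\<le>length ps. if j = nat k then of_real (2 * a * bern_weight ps j) else 0)"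
      by (intro sum.cong) (auto simp: scaleR_conv_of_real)
    \<comment> \<open>For \<open>k\<close> beyond \<open>length ps\<close> no summand matches, in
      agreement with the vanishing weight.\<close>
    also have "\<dots> = of_real (2 * a * bern_prob ps k)"
      using True by (auto simp: bern_prob_def bern_weight_eq_0)
    finally show ?thesis .
  next
    case False
    then have "int j \<noteq> k" for j by auto
    with False show ?thesis by (simp add: bern_prob_def)
  qed
  also have "(\<lambda>s. \<Sum>j\<le>length ps. bern_weight ps j *\<^sub>R (indicator {-a..a} s *\<^sub>R iexp (s * d j)))
      = (\<lambda>s. indicator {-a..a} s *\<^sub>R (bern_char ps s * iexp (- s * ((real_of_int k - sum_list ps) / bern_sd ps))))"
  proof
    fix s
    have "iexp (s * d j) = iexp (s * ((real j - sum_list ps) / bern_sd ps))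
        * iexp (- s * ((real_of_int k - sum_list ps) / bern_sd ps))" for j
      unfolding exp_add[symmetric] d_def distrib_left[symmetric] of_real_add[symmetric]
      by (simp add: diff_divide_distrib right_diff_distrib)
    then show "(\<Sum>j\<le>length ps. bern_weight ps j *\<^sub>R (indicator {-a..a} s *\<^sub>R iexp (s * d j)))
      = indicator {-a..a} s *\<^sub>R (bern_char ps s * iexp (- s * ((real_of_int k - sum_list ps) / bern_sd ps)))"
      unfolding bern_char_def bern_expect_def sum_distrib_right scaleR_sum_right
      by (intro sum.cong refl) (simp only: mult_scaleR_left scaleR_left_commute)
  qed
  finally show ?thesis .
qed

lemma integrable_gaussian: "0 < (\<sigma>::real) \<Longrightarrow> integrable lborel (\<lambda>x. exp (- (x\<^sup>2 / (2 * \<sigma>\<^sup>2))))"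
proof -
  assume "0 < \<sigma>"
  then have "integrable lborel (\<lambda>x. sqrt (2 * pi * \<sigma>\<^sup>2) * normal_density 0 \<sigma> x)"
    using normal_moment_even[of \<sigma> 0 0] by (intro integrable_mult_right) (auto simp: has_bochner_integral_iff)
  with \<open>0 < \<sigma>\<close> show ?thesis by (simp add: normal_density_def)
qed

text \<open>The Gaussian is its own Fourier transform up to scaling; this is read off from the
  characteristic function of the standard normal law at \<open>- x\<close>.\<close>

lemma gaussian_fourier:
  "has_bochner_integral lborel (\<lambda>s. of_real (exp (- s\<^sup>2 / 2)) * iexp (- s * x))
    (of_real (sqrt (2 * pi) * exp (- x\<^sup>2 / 2)))"
proof -
  have "integrable lborel (\<lambda>s. of_real (exp (- s\<^sup>2 / 2)) * iexp (- s * x))"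
    by (rule Bochner_Integration.integrable_bound[OF integrable_gaussian[of 1]]) (auto simp: norm_mult)
  moreover have "(LINT s|lborel. of_real (exp (- s\<^sup>2 / 2)) * iexp (- s * x))
      = of_real (sqrt (2 * pi)) * char std_normal_distribution (- x)"
  proof -
    have "char std_normal_distribution (- x) = (LINT s|lborel. std_normal_density s *\<^sub>R iexp (- x * s))"
      unfolding char_def by (rule integral_density) auto
    also have "\<dots> = (LINT s|lborel. of_real (1 / sqrt (2 * pi)) * (of_real (exp (- s\<^sup>2 / 2)) * iexp (- s * x)))"
      by (intro Bochner_Integration.integral_cong refl)
         (simp add: std_normal_density_def scaleR_conv_of_real mult_ac)
    also have "\<dots> = of_real (1 / sqrt (2 * pi)) * (LINT s|lborel. of_real (exp (- s\<^sup>2 / 2)) * iexp (- s * x))"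
      by (rule integral_mult_right_zero)
    finally show ?thesis by (simp flip: of_real_mult)
  qed
  ultimately show ?thesis
    by (simp add: has_bochner_integral_iff char_std_normal_distribution)
qed

text \<open>The L1 distance between the characteristic function cut off to one period and its
  Gaussian limit. It does not involve \<open>k\<close>, which is the source of uniformity.\<close>

definition bern_char_error :: "real list \<Rightarrow> real" where
  "bern_char_error ps = (LINT s|lborel.
     cmod (indicator {- (pi * bern_sd ps)..pi * bern_sd ps} s *\<^sub>R bern_char ps s - of_real (exp (- s\<^sup>2 / 2))))"

text \<open>Subtracting the two inversion formulas leaves an integral whose phase
  \<open>iexp (- s * x)\<close> has modulus 1, so the L1 error bounds it.\<close>

lemma bern_prob_approx:
  assumes ps: "set ps \<subseteq> {0..1}" and pos: "0 < bern_sd ps"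
  shows "\<bar>bern_sd ps * bern_prob ps k
      - exp (- ((real_of_int k - sum_list ps) / bern_sd ps)\<^sup>2 / 2) / sqrt (2 * pi)\<bar> \<le> bern_char_error ps"
proof -
  define a where "a = pi * bern_sd ps"
  define x where "x = (real_of_int k - sum_list ps) / bern_sd ps"
  let ?h = "\<lambda>s. indicator {-a..a} s *\<^sub>R bern_char ps s - of_real (exp (- s\<^sup>2 / 2))"
  have "has_bochner_integral lborel
      (\<lambda>s. indicator {-a..a} s *\<^sub>R (bern_char ps s * iexp (- s * x)) - of_real (exp (- s\<^sup>2 / 2)) * iexp (- s * x))
      (of_real (2 * a * bern_prob ps k) - of_real (sqrt (2 * pi) * exp (- x\<^sup>2 / 2)))"
    unfolding a_def x_def
    by (intro has_bochner_integral_diff bern_prob_fourier[OF ps pos] gaussian_fourier)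
  then have h: "has_bochner_integral lborel (\<lambda>s. ?h s * iexp (- s * x))
      (of_real (2 * a * bern_prob ps k) - of_real (sqrt (2 * pi) * exp (- x\<^sup>2 / 2)))"
    by (simp add: left_diff_distrib)
  have "\<bar>2 * a * bern_prob ps k - sqrt (2 * pi) * exp (- x\<^sup>2 / 2)\<bar>
      = cmod (LINT s|lborel. ?h s * iexp (- s * x))"
    unfolding has_bochner_integral_integral_eq[OF h] of_real_diff[symmetric] norm_of_real by simp
  also have "\<dots> \<le> (LINT s|lborel. cmod (?h s * iexp (- s * x)))"
    by (rule integral_norm_bound)
  also have "\<dots> = bern_char_error ps"
    by (simp add: bern_char_error_def a_def norm_mult)
  finally have le: "\<bar>2 * a * bern_prob ps k - sqrt (2 * pi) * exp (- x\<^sup>2 / 2)\<bar> \<le> bern_char_error ps" .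
  define r where "r = sqrt (2 * pi)"
  have r: "2 * pi = r * r" "0 < r" by (simp_all add: r_def)
  have "2 * pi * (exp (- x\<^sup>2 / 2) / r) = r * exp (- x\<^sup>2 / 2)"
    unfolding r(1) using r(2) by simp
  then have "2 * a * bern_prob ps k - sqrt (2 * pi) * exp (- x\<^sup>2 / 2)
      = (2 * pi) * (bern_sd ps * bern_prob ps k - exp (- x\<^sup>2 / 2) / sqrt (2 * pi))"
    by (simp add: a_def right_diff_distrib r_def)
  then have le': "(2 * pi) * \<bar>bern_sd ps * bern_prob ps k - exp (- x\<^sup>2 / 2) / sqrt (2 * pi)\<bar> \<le> bern_char_error ps"
    using le by (simp add: abs_mult)
  \<comment> \<open>The factor \<open>2 * pi\<close> exceeds 1 and is simply discarded.\<close>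
  have "1 * \<bar>bern_sd ps * bern_prob ps k - exp (- x\<^sup>2 / 2) / sqrt (2 * pi)\<bar>
      \<le> (2 * pi) * \<bar>bern_sd ps * bern_prob ps k - exp (- x\<^sup>2 / 2) / sqrt (2 * pi)\<bar>"
    using pi_ge_two by (intro mult_right_mono) auto
  from order_trans[OF this le'] show ?thesis by (simp add: x_def)
qed

lemma bern_char_error_tendsto:
  assumes ps: "\<And>n. set (ps n) \<subseteq> {0..1}"
    and sd: "filterlim (\<lambda>n. bern_sd (ps n)) at_top sequentially"
  shows "(\<lambda>n. bern_char_error (ps n)) \<longlonglongrightarrow> 0"
proof -
  let ?I = "\<lambda>n. {- (pi * bern_sd (ps n))..pi * bern_sd (ps n)}"
  \<comment> \<open>The first summand is the bound of \<open>norm_bern_char_le\<close>, written as a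
    Gaussian with standard deviation \<open>pi / 2\<close>; the second is the limit itself.\<close>
  let ?w = "\<lambda>s. exp (- (s\<^sup>2 / (2 * (pi / 2)\<^sup>2))) + exp (- (s\<^sup>2 / (2 * 1\<^sup>2)))"
  have "(\<lambda>n. bern_char_error (ps n)) \<longlonglongrightarrow> (LINT s::real|lborel. (0::real))"
    unfolding bern_char_error_def
  proof (rule integral_dominated_convergence[where w = ?w])
    show "integrable lborel ?w"
      by (intro Bochner_Integration.integrable_add integrable_gaussian) auto
    show "AE s in lborel. (\<lambda>n. cmod (indicator (?I n) s *\<^sub>R bern_char (ps n) s - of_real (exp (- s\<^sup>2 / 2)))) \<longlonglongrightarrow> 0"
    proof (rule AE_I2)
      fix s :: real
      \<comment> \<open>Each fixed \<open>s\<close> eventually lies inside the growing interval, so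
        the cutoff does not affect the pointwise limit.\<close>
      have "\<forall>\<^sub>F n in sequentially. \<bar>s\<bar> / pi < bern_sd (ps n)"
        using filterlim_at_top_dense[THEN iffD1, OF sd] by blast
      then have "\<forall>\<^sub>F n in sequentially. bern_char (ps n) s = indicator (?I n) s *\<^sub>R bern_char (ps n) s"
        by eventually_elim (auto simp: indicator_def field_simps abs_le_iff not_le)
      with bern_char_tendsto[OF ps sd]
      have "(\<lambda>n. indicator (?I n) s *\<^sub>R bern_char (ps n) s) \<longlonglongrightarrow> of_real (exp (- s\<^sup>2 / 2))"
        by (rule Lim_transform_eventually)
      then show "(\<lambda>n. cmod (indicator (?I n) s *\<^sub>R bern_char (ps n) s - of_real (exp (- s\<^sup>2 / 2)))) \<longlonglongrightarrow> 0"
        by (intro tendsto_norm_zero LIM_zero)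
    qed
    show "AE s in lborel. norm (cmod (indicator (?I n) s *\<^sub>R bern_char (ps n) s - of_real (exp (- s\<^sup>2 / 2)))) \<le> ?w s" for n
    proof (rule AE_I2)
      fix s :: real
      have "cmod (indicator (?I n) s *\<^sub>R bern_char (ps n) s) \<le> exp (- (s\<^sup>2 / (2 * (pi / 2)\<^sup>2)))"
        using norm_bern_char_le[OF ps, of s n] by (auto simp: indicator_def power_divide field_simps)
      then show "norm (cmod (indicator (?I n) s *\<^sub>R bern_char (ps n) s - of_real (exp (- s\<^sup>2 / 2)))) \<le> ?w s"
        unfolding real_norm_def abs_norm_cancel by (intro order_trans[OF norm_triangle_ineq4] add_mono) auto
    qed
  qed measurable
  then show ?thesis by simp
qed

text \<open>The derivative is bounded by 1 because \<open>\<bar>z\<bar> \<le> 1 + z\<^sup>2 / 2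
  \<le> exp (z\<^sup>2 / 2)\<close>. This absorbs the effect of the floor in the local limit
  theorem.\<close>

lemma exp_minus_square_lipschitz:
  "\<bar>exp (- x\<^sup>2 / 2) - exp (- y\<^sup>2 / 2)\<bar> \<le> \<bar>x - (y::real)\<bar>"
proof -
  have "norm (exp (- x\<^sup>2 / 2) - exp (- y\<^sup>2 / 2)) \<le> 1 * norm (x - y)"
  proof (rule field_differentiable_bound[where S = UNIV and f' = "\<lambda>z. - z * exp (- z\<^sup>2 / 2)"])
    show "((\<lambda>z. exp (- z\<^sup>2 / 2)) has_field_derivative - z * exp (- z\<^sup>2 / 2)) (at z within UNIV)" for z :: real
      by (auto intro!: derivative_eq_intros)
    show "norm (- z * exp (- z\<^sup>2 / 2)) \<le> 1" for z :: real
    proof -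
      have "\<bar>z\<bar> \<le> 1 + z\<^sup>2 / 2"
        using sum_squares_bound[of "\<bar>z\<bar>" 1] by simp
      also have "\<dots> \<le> exp (z\<^sup>2 / 2)" by (rule exp_ge_add_one_self)
      finally show ?thesis by (simp add: abs_mult exp_minus field_simps)
    qed
  qed auto
  then show ?thesis by simp
qed

theorem bern_local_limit:
  assumes ps: "\<And>n. set (ps n) \<subseteq> {0..1}"
    and sd: "filterlim (\<lambda>n. bern_sd (ps n)) at_top sequentially"
  shows "uniform_limit UNIV
    (\<lambda>n x. bern_sd (ps n) * bern_prob (ps n) \<lfloor>sum_list (ps n) + x * bern_sd (ps n)\<rfloor>)
    (\<lambda>x. exp (- (x\<^sup>2) / 2) / sqrt (2 * pi)) sequentially"
proof (rule uniform_limitI)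
  fix e :: real assume e: "0 < e"
  have "(\<lambda>n. bern_char_error (ps n) + 1 / bern_sd (ps n)) \<longlonglongrightarrow> 0"
    by (intro tendsto_add_zero bern_char_error_tendsto[OF ps sd]
          tendsto_divide_0[OF tendsto_const] filterlim_at_top_imp_at_infinity[OF sd])
  then have "\<forall>\<^sub>F n in sequentially. bern_char_error (ps n) + 1 / bern_sd (ps n) < e"
    using e by (rule order_tendstoD)
  moreover have "\<forall>\<^sub>F n in sequentially. 0 < bern_sd (ps n)"
    using filterlim_at_top_dense[THEN iffD1, OF sd] by blast
  ultimately show "\<forall>\<^sub>F n in sequentially. \<forall>x\<in>UNIV.
      dist (bern_sd (ps n) * bern_prob (ps n) \<lfloor>sum_list (ps n) + x * bern_sd (ps n)\<rfloor>)
        (exp (- (x\<^sup>2) / 2) / sqrt (2 * pi)) < e"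
  proof (eventually_elim, intro ballI)
    fix n and x :: real
    assume lt: "bern_char_error (ps n) + 1 / bern_sd (ps n) < e" and pos: "0 < bern_sd (ps n)"
    define k where "k = \<lfloor>sum_list (ps n) + x * bern_sd (ps n)\<rfloor>"
    \<comment> \<open>The standardised position of the lattice point: rounding moves
      \<open>x\<close> by at most 1/\<sigma>.\<close>
    define y where "y = (real_of_int k - sum_list (ps n)) / bern_sd (ps n)"
    have 1: "\<bar>bern_sd (ps n) * bern_prob (ps n) k - exp (- y\<^sup>2 / 2) / sqrt (2 * pi)\<bar> \<le> bern_char_error (ps n)"
      unfolding y_def by (rule bern_prob_approx[OF ps pos])
    have "\<bar>y - x\<bar> = \<bar>real_of_int k - (sum_list (ps n) + x * bern_sd (ps n))\<bar> / bern_sd (ps n)"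
      using pos by (simp add: y_def abs_divide[symmetric] field_simps)
    also have "\<dots> \<le> 1 / bern_sd (ps n)"
      using pos unfolding k_def by (intro divide_right_mono) linarith+
    finally have yx: "\<bar>y - x\<bar> \<le> 1 / bern_sd (ps n)" .
    have "1 \<le> sqrt (2 * pi)" using pi_ge_two by simp
    then have "\<bar>exp (- y\<^sup>2 / 2) / sqrt (2 * pi) - exp (- x\<^sup>2 / 2) / sqrt (2 * pi)\<bar> \<le> \<bar>exp (- y\<^sup>2 / 2) - exp (- x\<^sup>2 / 2)\<bar>"
      unfolding diff_divide_distrib[symmetric] abs_divide
      by (simp add: divide_le_eq mult_le_cancel_left1)
    also have "\<dots> \<le> \<bar>y - x\<bar>" by (rule exp_minus_square_lipschitz)
    finally show "dist (bern_sd (ps n) * bern_prob (ps n) \<lfloor>sum_list (ps n) + x * bern_sd (ps n)\<rfloor>)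
        (exp (- (x\<^sup>2) / 2) / sqrt (2 * pi)) < e"
      using 1 yx lt unfolding dist_real_def k_def[symmetric] by linarith
  qed
qed

section \<open>The central limit theorem\<close>

text \<open>Polya's theorem: by monotonicity it suffices to compare the two functions at the
  \<open>K\<close>-quantiles of the limit.\<close>

lemma uniform_limit_cdf:
  assumes M: "\<And>n. real_distribution (M n)" and M': "real_distribution M'"
    and cont: "\<And>x. isCont (cdf M') x" and conv: "weak_conv_m M M'"
  shows "uniform_limit UNIV (\<lambda>n. cdf (M n)) (cdf M') sequentially"
proof (rule uniform_limitI)
  fix e :: real assume e: "0 < e"
  interpret M': real_distribution M' by (rule M')
  let ?F = "cdf M'"
  \<comment> \<open>With \<open>K > 4 / e\<close>, a loss of two grid cells stays below
    \<open>e / 2\<close>; the other half of \<open>e\<close> is left for the error at the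
    quantiles.\<close>
  obtain K :: nat where K: "4 / e < real K" using reals_Archimedean2 by blast
  have K0: "0 < real K" using K e by (meson divide_pos_pos less_trans zero_less_numeral)
  have Ke: "2 / real K < e / 2" using K e K0 by (simp add: field_simps)
  then have Ke1: "1 / real K < e / 2" using divide_right_mono[of 1 2 "real K"] K0 by linarith
  have "\<exists>y. ?F y = real j / K" if j: "0 < j" "j < K" for j
  proof -
    have "\<forall>\<^sub>F y in at_bot. ?F y < real j / K"
      using j by (intro order_tendstoD(2)[OF M'.cdf_lim_at_bot]) auto
    then obtain a where a: "\<And>y. y \<le> a \<Longrightarrow> ?F y < real j / K" by (auto simp: eventually_at_bot_linorder)
    have "\<forall>\<^sub>F y in at_top. real j / K < ?F y"
      using j by (intro order_tendstoD(1)[OF M'.cdf_lim_at_top_prob]) auto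
    then obtain b where b: "\<And>y. y \<ge> b \<Longrightarrow> real j / K < ?F y" by (auto simp: eventually_at_top_linorder)
    have "\<exists>y\<ge>a. y \<le> max a b \<and> ?F y = real j / K"
      using a[of a] b[of "max a b"] cont by (intro IVT) (auto intro: less_imp_le)
    then show ?thesis by blast
  qed
  then obtain y where y: "\<And>j. 0 < j \<Longrightarrow> j < K \<Longrightarrow> ?F (y j) = real j / K" by metis
  have ylt: "x < y j" if "0 < j" "j < K" "?F x < real j / K" for x j
    using that y[of j] M'.cdf_nondecreasing[of "y j" x] by (cases "x < y j") auto
  have ygt: "y j < x" if "0 < j" "j < K" "real j / K < ?F x" for x j
    using that y[of j] M'.cdf_nondecreasing[of x "y j"] by (cases "y j < x") auto
  \<comment> \<open>Only finitely many quantiles are involved, so pointwise convergence holds at all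
    of them simultaneously.\<close>
  have "\<forall>\<^sub>F n in sequentially. \<forall>j\<in>{0<..<K}. dist (cdf (M n) (y j)) (?F (y j)) < e / 2"
    using conv cont e unfolding weak_conv_m_def weak_conv_def
    by (intro eventually_ball_finite ballI tendstoD) auto
  then show "\<forall>\<^sub>F n in sequentially. \<forall>x\<in>UNIV. dist (cdf (M n) x) (?F x) < e"
  proof (eventually_elim, intro ballI)
    fix n x
    interpret Mn: real_distribution "M n" by (rule M)
    assume close: "\<forall>j\<in>{0<..<K}. dist (cdf (M n) (y j)) (?F (y j)) < e / 2"
    define j where "j = nat \<lfloor>real K * ?F x\<rfloor>"
    have "real j = \<lfloor>real K * ?F x\<rfloor>"
      using M'.cdf_nonneg[of x] K0 by (simp add: j_def)
    then have j: "real j \<le> real K * ?F x" "real K * ?F x < real j + 1" by linarith+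
    have up: "?F x < real (Suc j) / K" and lo: "real j / K \<le> ?F x"
      using j K0 by (simp_all add: field_simps)
    \<comment> \<open>Compare with the next quantile to the right. In the last cell there is none,
      and the bound 1 on distribution functions takes its place.\<close>
    have "cdf (M n) x < ?F x + e"
    proof (cases "Suc j < K")
      case True
      have "cdf (M n) x \<le> cdf (M n) (y (Suc j))"
        using ylt[OF _ True up] by (intro Mn.cdf_nondecreasing) simp
      also have "dist (cdf (M n) (y (Suc j))) (real (Suc j) / K) < e / 2"
        using bspec[OF close, of "Suc j"] True y[of "Suc j"] by (simp del: of_nat_Suc)
      then have "cdf (M n) (y (Suc j)) < real (Suc j) / K + e / 2"
        unfolding dist_real_def by linarith
      also have "\<dots> = real j / K + 1 / K + e / 2" by (simp add: add_divide_distrib)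
      finally show ?thesis using lo Ke1 by linarith
    next
      case False
      then have "1 \<le> real (Suc j) / K" using K0 by (simp add: field_simps)
      then have "1 \<le> real j / K + 1 / K" by (simp add: add_divide_distrib)
      with lo Ke1 e Mn.cdf_bounded_prob[of x] show ?thesis by linarith
    qed
    \<comment> \<open>The index \<open>j - 1\<close> replaces \<open>j\<close> because
      \<open>?F x\<close> may equal \<open>j / K\<close>, whereas \<open>ygt\<close> needs strict
      inequality, and because \<open>j\<close> may be \<open>K\<close>. This costs two cells; for
      \<open>j \<le> 1\<close> nonnegativity suffices.\<close>
    moreover have "?F x - e < cdf (M n) x"
    proof (cases "1 < j")
      case True
      have jK: "j - 1 < K"
      proof -
        have "real K * ?F x \<le> real K" using M'.cdf_bounded_prob[of x] K0 by simp
        with j(1) have "real j \<le> real K" by linarith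
        with True show ?thesis by linarith
      qed
      have "real (j - 1) / K < real j / K" using True K0 by (intro divide_strict_right_mono) auto
      with lo have "real (j - 1) / K < ?F x" by linarith
      from ygt[OF _ jK this] True have "y (j - 1) < x" by simp
      then have "cdf (M n) (y (j - 1)) \<le> cdf (M n) x" by (intro Mn.cdf_nondecreasing) simp
      moreover have "dist (cdf (M n) (y (j - 1))) (real (j - 1) / K) < e / 2"
        using bspec[OF close, of "j - 1"] True jK y[of "j - 1"] by (simp del: of_nat_diff)
      then have "real (j - 1) / K - e / 2 < cdf (M n) (y (j - 1))"
        unfolding dist_real_def by linarith
      moreover have "real (j - 1) / K = real (Suc j) / K - 2 / K"
        using True by (simp add: diff_divide_distrib[symmetric] of_nat_diff)
      ultimately show ?thesis using up Ke by linarith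
    next
      case False
      then have "real (Suc j) / K \<le> 2 / K" using K0 by (intro divide_right_mono) auto
      with up Ke e Mn.cdf_nonneg[of x] show ?thesis by linarith
    qed
    ultimately show "dist (cdf (M n) x) (?F x) < e" by (simp add: dist_real_def abs_less_iff)
  qed
qed

text \<open>The law of the standardised sum as a measure on the reals, the form required by Levy's
  continuity theorem.\<close>

definition bern_dist :: "real list \<Rightarrow> real measure" where
  "bern_dist ps = distr (measure_pmf (embed_pmf (bern_weight ps))) borel
     (\<lambda>k. (real k - sum_list ps) / bern_sd ps)"

lemma integral_bern_pmf:
  fixes f :: "nat \<Rightarrow> 'b::{banach, second_countable_topology}"
  assumes ps: "set ps \<subseteq> {0..1}"
  shows "(LINT k|measure_pmf (embed_pmf (bern_weight ps)). f k) = bern_expect ps f"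
proof -
  have "(\<integral>\<^sup>+k. ennreal (bern_weight ps k) \<partial>count_space UNIV) = (\<Sum>k\<le>length ps. ennreal (bern_weight ps k))"
    by (rule nn_integral_count_space') (auto simp: bern_weight_eq_0)
  also have "\<dots> = ennreal (bern_expect ps (\<lambda>_. 1))"
    using ps by (simp add: bern_expect_def bern_weight_nonneg)
  \<comment> \<open>Total mass 1 is what makes \<open>embed_pmf\<close> reproduce the given
    weights.\<close>
  finally have "(\<integral>\<^sup>+k. ennreal (bern_weight ps k) \<partial>count_space UNIV) = 1"
    by (simp add: bern_expect_const)
  then have pmf: "pmf (embed_pmf (bern_weight ps)) k = bern_weight ps k" for k
    by (intro pmf_embed_pmf bern_weight_nonneg[OF ps])
  have "(LINT k|measure_pmf (embed_pmf (bern_weight ps)). f k)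
      = (\<Sum>k\<le>length ps. pmf (embed_pmf (bern_weight ps)) k *\<^sub>R f k)"
    by (rule integral_measure_pmf) (auto simp: set_pmf_eq pmf dest: bern_weight_eq_0 intro: leI)
  then show ?thesis by (simp add: pmf bern_expect_def)
qed

lemma real_distribution_bern_dist: "real_distribution (bern_dist ps)"
  unfolding bern_dist_def by (intro prob_space.real_distribution_distr[OF prob_space_measure_pmf]) simp

lemma char_bern_dist: "set ps \<subseteq> {0..1} \<Longrightarrow> char (bern_dist ps) = bern_char ps"
  unfolding char_def bern_dist_def
  by (subst integral_distr) (auto simp: integral_bern_pmf bern_char_def)

lemma cdf_bern_dist:
  assumes ps: "set ps \<subseteq> {0..1}" and pos: "0 < bern_sd ps"
  shows "cdf (bern_dist ps) x
    = (\<Sum>k\<in>{k. k \<le> length ps \<and> real k \<le> sum_list ps + x * bern_sd ps}. bern_prob ps (int k))"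
proof -
  let ?A = "{k. real k \<le> sum_list ps + x * bern_sd ps}"
  have "cdf (bern_dist ps) x = measure (measure_pmf (embed_pmf (bern_weight ps))) ?A"
    using pos unfolding cdf_def bern_dist_def
    by (subst measure_distr) (auto simp: field_simps intro!: arg_cong[where f = "measure _"])
  also have "\<dots> = (LINT k|measure_pmf (embed_pmf (bern_weight ps)). indicator ?A k)"
    by simp
  also have "\<dots> = (\<Sum>k\<le>length ps. bern_weight ps k *\<^sub>R indicator ?A k)"
    unfolding integral_bern_pmf[OF ps] bern_expect_def ..
  also have "\<dots> = (\<Sum>k\<in>{k. k \<le> length ps \<and> real k \<le> sum_list ps + x * bern_sd ps}. bern_prob ps (int k))"
    by (rule sum.mono_neutral_cong_right) (auto simp: bern_prob_def)
  finally show ?thesis .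
qed

lemma cdf_std_normal:
  "cdf std_normal_distribution x = (1 / sqrt (2 * pi)) * (LBINT t:{..x}. exp (- (t\<^sup>2) / 2))"
proof -
  interpret real_distribution std_normal_distribution by (rule real_dist_normal_dist)
  have "cdf std_normal_distribution x = (LINT t|std_normal_distribution. indicator {..x} t)"
    by (simp add: cdf_def)
  also have "\<dots> = (LINT t|lborel. std_normal_density t *\<^sub>R indicator {..x} t)"
    by (rule integral_density) auto
  also have "\<dots> = (LINT t|lborel. (1 / sqrt (2 * pi)) * (indicator {..x} t *\<^sub>R exp (- (t\<^sup>2) / 2)))"
    by (intro Bochner_Integration.integral_cong) (auto simp: std_normal_density_def)
  finally show ?thesis by (simp add: set_lebesgue_integral_def)
qed

theorem bern_central_limit:
  assumes ps: "\<And>n. set (ps n) \<subseteq> {0..1}"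
    and sd: "filterlim (\<lambda>n. bern_sd (ps n)) at_top sequentially"
  shows "uniform_limit UNIV
    (\<lambda>n x. \<Sum>k\<in>{k. k \<le> length (ps n) \<and> real k \<le> sum_list (ps n) + x * bern_sd (ps n)}. bern_prob (ps n) (int k))
    (cdf std_normal_distribution) sequentially"
proof -
  interpret std: real_distribution std_normal_distribution by (rule real_dist_normal_dist)
  \<comment> \<open>A law with a density has no atoms, so its distribution function is continuous,
    as Polya's theorem requires.\<close>
  have "measure std_normal_distribution {x} = 0" for x
    by (simp add: measure_def emeasure_density nn_integral_cmult_indicator[symmetric] nn_integral_null_set)
  then have cont: "isCont (cdf std_normal_distribution) x" for x
    by (simp add: std.isCont_cdf)
  have "weak_conv_m (\<lambda>n. bern_dist (ps n)) std_normal_distribution"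
    using bern_char_tendsto[OF ps sd]
    by (intro levy_continuity real_distribution_bern_dist real_dist_normal_dist)
       (simp add: char_bern_dist[OF ps] char_std_normal_distribution)
  then have "uniform_limit UNIV (\<lambda>n. cdf (bern_dist (ps n))) (cdf std_normal_distribution) sequentially"
    by (intro uniform_limit_cdf real_distribution_bern_dist real_dist_normal_dist cont)
  \<comment> \<open>Standardising can be undone only for positive standard deviation, so the sum
    formula for the distribution function is available eventually.\<close>
  moreover have "\<forall>\<^sub>F n in sequentially. 0 < bern_sd (ps n)"
    using filterlim_at_top_dense[THEN iffD1, OF sd] by blast
  then have "\<forall>\<^sub>F n in sequentially. \<forall>x\<in>UNIV. cdf (bern_dist (ps n)) x =
      (\<Sum>k\<in>{k. k \<le> length (ps n) \<and> real k \<le> sum_list (ps n) + x * bern_sd (ps n)}. bern_prob (ps n) (int k))"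
    by eventually_elim (simp add: cdf_bern_dist[OF ps])
  ultimately show ?thesis
    by (rule uniform_limit_cong[THEN iffD1, rotated 2]) auto
qed

section \<open>Laplacian coefficients\<close>

lemma uniform_limit_imp_SUP_tendsto_0:
  fixes f :: "nat \<Rightarrow> 'a \<Rightarrow> real"
  assumes "uniform_limit UNIV f g sequentially"
  shows "(\<lambda>n. SUP x. \<bar>f n x - g x\<bar>) \<longlonglongrightarrow> 0"
proof (rule tendstoI)
  fix e :: real assume "0 < e"
  \<comment> \<open>Half of \<open>e\<close> is used because a supremum of values below a bound may
    attain that bound.\<close>
  then have "\<forall>\<^sub>F n in sequentially. \<forall>x\<in>UNIV. dist (f n x) (g x) < e / 2"
    by (intro uniform_limitD[OF assms]) simp
  then show "\<forall>\<^sub>F n in sequentially. dist (SUP x. \<bar>f n x - g x\<bar>) 0 < e"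
  proof eventually_elim
    fix n assume *: "\<forall>x\<in>UNIV. dist (f n x) (g x) < e / 2"
    then have le: "\<bar>f n x - g x\<bar> \<le> e / 2" for x by (auto simp: dist_real_def intro: less_imp_le)
    have "(SUP x. \<bar>f n x - g x\<bar>) \<le> e / 2"
      by (intro cSUP_least le) auto
    \<comment> \<open>Any point shows that the supremum is nonnegative; \<open>undefined\<close>
      serves as one.\<close>
    moreover have "0 \<le> \<bar>f n undefined - g undefined\<bar>" by simp
    moreover have "\<bar>f n undefined - g undefined\<bar> \<le> (SUP x. \<bar>f n x - g x\<bar>)"
      using le by (intro cSUP_upper bdd_aboveI[of _ "e / 2"]) auto
    ultimately show "dist (SUP x. \<bar>f n x - g x\<bar>) 0 < e"
      using \<open>0 < e\<close> by (simp add: dist_real_def)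
  qed
qed

text \<open>Dividing \<open>\<Prod>(x + l)\<close> by its value at \<open>x = 1\<close> gives the generating function of a sum of
  independent Bernoulli variables with success probabilities \<open>1 / (1 + l)\<close>.\<close>

lemma coeff_prod_linear_factors:
  fixes ls :: "real list"
  assumes "\<And>l. l \<in> set ls \<Longrightarrow> 0 \<le> l" "k \<le> length ls"
  shows "(-1) ^ (length ls - k) * coeff (\<Prod>l\<leftarrow>ls. [:- l, 1:]) k
    = (\<Prod>l\<leftarrow>ls. 1 + l) * bern_weight (map (\<lambda>l. 1 / (1 + l)) ls) k"
  using assms
proof (induction ls arbitrary: k)
  case Nil
  then show ?case by simp
next
  case (Cons l ls)
  let ?P = "\<Prod>l\<leftarrow>ls. [:- l, 1:]" and ?n = "length ls" and ?c = "\<Prod>l\<leftarrow>ls. 1 + l"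
  let ?w = "bern_weight (map (\<lambda>l. 1 / (1 + l)) ls)"
  have l: "1 + l \<noteq> 0" using Cons.prems(1)[of l] by simp
  have IH: "(-1) ^ (?n - j) * coeff ?P j = ?c * ?w j" if "j \<le> ?n" for j
    using Cons.IH[of j] Cons.prems(1) that by simp
  have "degree ?P = ?n"
    by (subst degree_prod_list_eq) (auto simp: o_def sum_list_triv)
  then have top: "coeff ?P (Suc ?n) = 0" by (simp add: coeff_eq_0)
  \<comment> \<open>For \<open>k \<le> ?n\<close> the sign exponent grows by one and cancels the
    minus of \<open>- l\<close>. At \<open>k = Suc ?n\<close>, where \<open>?n - k\<close> would be
    truncated, both sides vanish.\<close>
  have 1: "(-1) ^ (Suc ?n - k) * (- l * coeff ?P k) = l * (?c * ?w k)"
  proof (cases "k \<le> ?n")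
    case True
    with IH[of k] show ?thesis by (simp add: Suc_diff_le)
  next
    case False
    with Cons.prems(2) have "k = Suc ?n" by simp
    then show ?thesis using top by (simp add: bern_weight_eq_0)
  qed
  have 2: "(-1) ^ (Suc ?n - k) * (case k of 0 \<Rightarrow> 0 | Suc j \<Rightarrow> coeff ?P j)
      = ?c * (case k of 0 \<Rightarrow> 0 | Suc j \<Rightarrow> ?w j)"
    using IH Cons.prems(2) by (auto split: nat.split)
  have "(-1) ^ (length (l # ls) - k) * coeff (\<Prod>l\<leftarrow>l # ls. [:- l, 1:]) k
      = (-1) ^ (Suc ?n - k) * (- l * coeff ?P k)
        + (-1) ^ (Suc ?n - k) * (case k of 0 \<Rightarrow> 0 | Suc j \<Rightarrow> coeff ?P j)"
    by (simp add: coeff_pCons algebra_simps split: nat.split)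
  also have "\<dots> = ?c * (l * ?w k + (case k of 0 \<Rightarrow> 0 | Suc j \<Rightarrow> ?w j))"
    unfolding 1 2 by (simp only: distrib_left mult.left_commute[of l])
  also have "l * ?w k + (case k of 0 \<Rightarrow> 0 | Suc j \<Rightarrow> ?w j)
      = (1 + l) * bern_weight (map (\<lambda>l. 1 / (1 + l)) (l # ls)) k"
  proof -
    \<comment> \<open>Multiplying by \<open>1 + l\<close> turns the failure and success
      probabilities into the weights \<open>l\<close> and 1.\<close>
    have "1 - 1 / (1 + l) = l / (1 + l)" using l by (simp add: field_simps)
    with l show ?thesis by (cases k) (simp_all add: distrib_left)
  qed
  finally show ?case by (simp add: mult_ac)
qed

text \<open>Bernoulli weights sum to 1, so the common factor \<open>c\<close> is exactly the sum of
  all Laplacian coefficients and cancels in the normalisation.\<close>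

lemma lap_prob_eq_bern_prob:
  assumes len: "length ls = N" and nonneg: "\<And>l. l \<in> set ls \<Longrightarrow> 0 \<le> l"
    and cp: "char_poly (laplacian N adj) = (\<Prod>l\<leftarrow>ls. [:- l, 1:])"
  defines "ps \<equiv> map (\<lambda>l. 1 / (1 + l)) ls"
  shows "lap_prob N adj k = bern_prob ps k"
    and "lap_mean N adj = sum_list ps" and "lap_sd N adj = bern_sd ps"
proof -
  define c where "c = (\<Prod>l\<leftarrow>ls. 1 + l)"
  have c: "0 < c" using nonneg unfolding c_def by (induction ls) (auto intro!: mult_pos_pos add_pos_nonneg)
  have coeff: "lap_coeff N adj k = c * bern_weight ps k" if "k \<le> N" for k
    using coeff_prod_linear_factors[OF nonneg, of ls k] that
    by (simp add: lap_coeff_def cp len ps_def c_def)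
  have lps: "length ps = N" by (simp add: ps_def len)
  have "(\<Sum>j\<le>N. lap_coeff N adj j) = c * bern_expect ps (\<lambda>_. 1)"
    by (simp add: coeff bern_expect_def lps sum_distrib_left)
  then have total: "(\<Sum>j\<le>N. lap_coeff N adj j) = c" by (simp add: bern_expect_const)
  show prob: "lap_prob N adj k = bern_prob ps k" for k
  proof (cases "0 \<le> k \<and> k \<le> int N")
    case True
    with c coeff[of "nat k"] show ?thesis by (auto simp: lap_prob_def bern_prob_def total)
  next
    case False
    then show ?thesis by (auto simp: lap_prob_def bern_prob_def lps bern_weight_eq_0)
  qed
  show mean: "lap_mean N adj = sum_list ps"
    unfolding bern_expect_mean[symmetric] lap_mean_def prob
    by (simp add: bern_expect_def lps bern_prob_def mult.commute)
  show "lap_sd N adj = bern_sd ps"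
    unfolding lap_sd_def lap_var_def mean prob bern_sd_def bern_expect_variance[symmetric]
    by (simp add: bern_expect_def lps bern_prob_def mult.commute)
qed

text \<open>An eigenvalue \<open>l\<close> contributes \<open>l / (1 + l)\<^sup>2\<close>; enlarging
  every denominator to the common bound leaves the trace in the numerator.\<close>

lemma bern_var_ge:
  assumes "\<And>l. l \<in> set ls \<Longrightarrow> 0 \<le> l \<and> l \<le> b"
  shows "sum_list ls / (1 + b)\<^sup>2 \<le> bern_var (map (\<lambda>l. 1 / (1 + l)) ls)"
  using assms
proof (induction ls)
  case (Cons l ls)
  then have l: "0 \<le> l" "l \<le> b" by auto
  have "l / (1 + b)\<^sup>2 \<le> l / (1 + l)\<^sup>2"
    using l by (intro divide_left_mono power_mono mult_pos_pos) auto
  also have "\<dots> = 1 / (1 + l) * (1 - 1 / (1 + l))"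
    using l by (simp add: field_simps power2_eq_square)
  finally show ?case using Cons by (simp add: add_divide_distrib)
qed simp

theorem theorem2p3:
  fixes N :: "nat \<Rightarrow> nat" and adj :: "nat \<Rightarrow> nat \<Rightarrow> nat \<Rightarrow> bool"
  assumes graphs: "\<And>n. simple_graph (N n) (adj n)"
    and incr: "strict_mono (\<lambda>n. num_edges (N n) (adj n))"
    and sparse: "(\<lambda>n. real (max_degree (N n) (adj n)) ^ 2) \<in> o(\<lambda>n. real (num_edges (N n) (adj n)))"
  shows "lap_CLT N adj \<and> lap_LLT N adj"
proof -
  let ?E = "\<lambda>n. real (num_edges (N n) (adj n))" and ?\<Delta> = "\<lambda>n. real (max_degree (N n) (adj n))"
  have "\<exists>ls. length ls = N n \<and> (\<forall>l\<in>set ls. 0 \<le> l \<and> l \<le> 2 * ?\<Delta> n) \<and> sum_list ls = 2 * ?E n \<and>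
      char_poly (laplacian (N n) (adj n)) = (\<Prod>l\<leftarrow>ls. [:- l, 1:])" for n
    by (rule laplacian_spectrum[OF graphs[of n]]) blast
  then obtain ls where ls: "\<And>n. length (ls n) = N n"
    "\<And>n l. l \<in> set (ls n) \<Longrightarrow> 0 \<le> l \<and> l \<le> 2 * ?\<Delta> n"
    "\<And>n. sum_list (ls n) = 2 * ?E n"
    "\<And>n. char_poly (laplacian (N n) (adj n)) = (\<Prod>l\<leftarrow>ls n. [:- l, 1:])"
    by metis
  define ps where "ps n = map (\<lambda>l. 1 / (1 + l)) (ls n)" for n
  have len: "length (ps n) = N n" for n by (simp add: ps_def ls)
  have ps: "set (ps n) \<subseteq> {0..1}" for n
    using ls(2) by (auto simp: ps_def divide_le_eq_1)
  have lap: "lap_prob (N n) (adj n) k = bern_prob (ps n) k" "lap_mean (N n) (adj n) = sum_list (ps n)"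
    "lap_sd (N n) (adj n) = bern_sd (ps n)" for n k
    using lap_prob_eq_bern_prob[OF ls(1) _ ls(4)] ls(2) unfolding ps_def by blast+
  have sd: "filterlim (\<lambda>n. bern_sd (ps n)) at_top sequentially"
    unfolding filterlim_at_top_gt[where c = 0]
  proof (intro allI impI)
    fix Z :: real assume Z: "0 < Z"
    \<comment> \<open>Chosen so that \<open>10 * c\<close> equals \<open>2 / Z\<^sup>2\<close>, the
      ratio needed at the end.\<close>
    define c where "c = 1 / (5 * Z\<^sup>2)"
    have c: "0 < c" using Z by (simp add: c_def)
    have "\<forall>\<^sub>F n in sequentially. norm (?\<Delta> n ^ 2) \<le> c * norm (?E n)"
      by (rule landau_o.smallD[OF sparse c])
    moreover have "\<forall>\<^sub>F n in sequentially. 1 / c \<le> real n"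
      by real_asymp
    ultimately show "\<forall>\<^sub>F n in sequentially. Z \<le> bern_sd (ps n)"
    proof eventually_elim
      fix n assume d: "norm (?\<Delta> n ^ 2) \<le> c * norm (?E n)" and n: "1 / c \<le> real n"
      \<comment> \<open>A strictly increasing sequence of naturals dominates its index, so the edge
        counts eventually exceed \<open>1 / c\<close>.\<close>
      have "real n \<le> ?E n" using strict_mono_imp_increasing[OF incr, of n] by simp
      with n have "1 / c \<le> ?E n" by linarith
      then have E1: "1 \<le> c * ?E n" using c by (simp add: field_simps)
      \<comment> \<open>The constant 2 is absorbed by \<open>1 \<le> c * ?E n\<close> and the
        quadratic term by sparsity, for a total of \<open>10 * c * ?E n\<close>.\<close>
      have "(1 + 2 * ?\<Delta> n)\<^sup>2 \<le> 2 + 8 * (?\<Delta> n)\<^sup>2"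
        using sum_squares_bound[of 1 "2 * ?\<Delta> n"] by (simp add: power2_sum power_mult_distrib)
      also have "\<dots> \<le> 10 * c * ?E n" using d E1 by simp
      also have "\<dots> = 2 * ?E n / Z\<^sup>2" by (simp add: c_def)
      finally have "Z\<^sup>2 * (1 + 2 * ?\<Delta> n)\<^sup>2 \<le> sum_list (ls n)"
        using Z by (simp add: ls field_simps)
      then have "Z\<^sup>2 \<le> sum_list (ls n) / (1 + 2 * ?\<Delta> n)\<^sup>2"
        by (subst pos_le_divide_eq) (auto intro!: zero_less_power add_pos_nonneg)
      also have "\<dots> \<le> bern_var (ps n)"
        unfolding ps_def by (rule bern_var_ge[OF ls(2)])
      finally show "Z \<le> bern_sd (ps n)"
        unfolding bern_sd_def by (rule real_le_rsqrt)
    qed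
  qed
  have "lap_CLT N adj"
    using uniform_limit_imp_SUP_tendsto_0[OF bern_central_limit[OF ps sd]]
    unfolding lap_CLT_def lap std_normal_cdf_def cdf_std_normal len .
  moreover have "lap_LLT N adj"
    using uniform_limit_imp_SUP_tendsto_0[OF bern_local_limit[OF ps sd]]
    unfolding lap_LLT_def lap .
  ultimately show ?thesis ..
qed

end
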